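(* Let $\mathcal{S}$ be a finite collection of finite sets and $J=\bigcup_{S\in\mathcal{S}}S$. Let $\mathcal{S}',\alpha,\mathcal{T}'$ be the output of the reformulation algorithm (described in the context) for $\mathrm{CDC}(\mathcal{S})$, let $J'=\bigcup_{S'\in\mathcal{S}'}S'$, and let $\{\{A'^{,j},B'^{,j}\}\}_{j=1}^t$ be the biclique cover of the conflict graph of $\mathrm{CDC}(\mathcal{S}')$ returned by the biclique cover algorithm (described in the context) applied to $\mathcal{T}'$. Then an ideal formulation of $\mathrm{CDC}(\mathcal{S})$ is $$\lambda_v=\sum_{u:\alpha(u)=v}\lambda'_u\ \ (v\in J),\qquad\sum_{v\in A'^{,j}}\lambda'_v\le z_j,\quad\sum_{v\in B'^{,j}}\lambda'_v\le 1-z_j,\quad z_j\in\{0,1\}\ \ (j=1,\dots,t),\qquad\lambda'\in\Delta^{J'}.$$ If $\lambda$ is projected out using the first family of equations, the number of auxiliary continuous variables, $|J'|-|J|$, equals $\sum_{S\in\mathcal{S}}|S|-w(\mathcal{T}')-|\bigcup_{S\in\mathcal{S}}S|$; the number of binary variables is $t\le|\mathcal{S}'|-1=|\mathcal{S}|-1$; and the number of inequality constraints besides variable bounds is $2t$.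
   Context: For a finite collection $\mathcal{S}$ of finite sets with $J=\bigcup_{S\in\mathcal{S}}S$, let $\Delta^J=\{\lambda\in\mathbb{R}^J_{\ge0}:\sum_{v\in J}\lambda_v=1\}$, $Q(S):=\{\lambda\in\Delta^J:\lambda_{J\setminus S}=0\}$, $\mathrm{CDC}(\mathcal{S}):=\bigcup_{S\in\mathcal{S}}Q(S)$. The intersection graph $\mathcal{K}_{\mathcal{S}}$ is the complete graph on $\mathcal{S}$; an edge $S^1S^2$ has $\mathrm{mid}(S^1S^2)=S^1\cap S^2$ and weight $w(S^1S^2)=|S^1\cap S^2|$; $w(\mathcal{T})$ is the sum of the edge weights of $\mathcal{T}$. The conflict graph of $\mathrm{CDC}(\mathcal{S})$ has vertex set $J$, distinct $u,v$ being adjacent iff $\{u,v\}\not\subseteq S$ for all $S\in\mathcal{S}$. A biclique $\{A,B\}$ is a complete bipartite graph with disjoint parts $A,B$ (a part may be empty); a biclique cover of a graph is a collection of biclique subgraphs covering all edges. A formulation of $\mathrm{CDC}(\mathcal{S})$ is a system whose feasible set projects onto $\mathrm{CDC}(\mathcal{S})$ in the $\lambda$-coordinates; it is ideal if each extreme point of its LP relaxation satisfies the integrality conditions. Reformulation algorithm for $\mathcal{S}=\{S^i\}_{i=1}^d$: create pairwise disjoint sets $S'^{,1},\dots,S'^{,d}$ of new indices and $\alpha$ mapping each $S'^{,i}$ bijectively onto $S^i$. Compute a maximum spanning tree $\mathcal{T}$ of $\mathcal{K}_{\mathcal{S}}$ and set $\mathcal{S}_{\mathrm{select}}:=\{S^1\}$.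 While $|\mathcal{S}_{\mathrm{select}}|<d$: find an edge $S^iS^j$ of $\mathcal{T}$ with $S^i\in\mathcal{S}_{\mathrm{select}}$, $S^j\notin\mathcal{S}_{\mathrm{select}}$; add $S^j$ to $\mathcal{S}_{\mathrm{select}}$; for all $x\in S'^{,i}$, $y\in S'^{,j}$ with $\alpha(x)=\alpha(y)$, replace $y$ by $x$ in $S'^{,j}$. Output $\mathcal{S}'=\{S'^{,i}\}_{i=1}^d$, $\alpha$ restricted to $\bigcup_iS'^{,i}$, and the tree $\mathcal{T}'$ obtained from $\mathcal{T}$ by replacing each vertex $S^i$ by $S'^{,i}$ (with weights $w$ computed from the sets $S'^{,i}$). Biclique cover algorithm on a tree. Separation subroutine: a tree with at most one vertex gives the empty tuple; otherwise choose an edge $e$ whose removal leaves components $\mathcal{T}_1,\mathcal{T}_2$ with $\big||V(\mathcal{T}_1)|-|V(\mathcal{T}_2)|\big|$ minimal, form the biclique $\{\bigcup_{S\in V(\mathcal{T}_1)}S\setminus\mathrm{mid}(e),\ \bigcup_{S\in V(\mathcal{T}_2)}S\setminus\mathrm{mid}(e)\}$, recurse on $\mathcal{T}_1,\mathcal{T}_2$ to get tuples $bc_1,bc_2$, and return the tuple consisting of this biclique, the first element of $bc_1$, the first element of $bc_2$ (if any), the rest of $bc_1$, and the rest of $bc_2$. Merging: process the bicliques $\{A,B\}$ in order, keeping a tuple of merged bicliques; if for some merged $\{A',B'\}$ (scanned in order) $\{A'\cup A,B'\cup B\}$, or else $\{A'\cup B,B'\cup A\}$, is a biclique subgraph of the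 conflict graph, replace the first such $\{A',B'\}$ by it; otherwise append $\{A,B\}$. Return the set of merged bicliques. *)

theory Defs
  imports "HOL-Analysis.Polytope" "HOL-Library.Function_Algebras" "HOL-Library.Disjoint_Sets"
begin

section \<open>Finite undirected simple graphs\<close>

text \<open>Edges are two-element vertex sets.\<close>

record 'v ugraph =
  verts :: "'v set"
  edges :: "'v set set"

definition all_pairs :: "'v set \<Rightarrow> 'v set set" where
  "all_pairs V = {{u, v} | u v. u \<in> V \<and> v \<in> V \<and> u \<noteq> v}"

definition is_ugraph :: "'v ugraph \<Rightarrow> bool" where
  "is_ugraph G \<longleftrightarrow> finite (verts G) \<and> edges G \<subseteq> all_pairs (verts G)"

definition adj :: "'v ugraph \<Rightarrow> 'v \<Rightarrow> 'v \<Rightarrow> bool" where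
  "adj G u v \<longleftrightarrow> {u, v} \<in> edges G"

definition connected_ugraph :: "'v ugraph \<Rightarrow> bool" where
  "connected_ugraph G \<longleftrightarrow> verts G \<noteq> {} \<and> (\<forall>u\<in>verts G. \<forall>v\<in>verts G. (adj G)\<^sup>*\<^sup>* u v)"

definition is_cycle :: "'v ugraph \<Rightarrow> 'v list \<Rightarrow> bool" where
  "is_cycle G xs \<longleftrightarrow> 3 \<le> length xs \<and> distinct xs \<and>
     (\<forall>i<length xs. adj G (xs ! i) (xs ! (Suc i mod length xs)))"

definition is_tree :: "'v ugraph \<Rightarrow> bool" where
  "is_tree T \<longleftrightarrow> is_ugraph T \<and> connected_ugraph T \<and> (\<nexists>xs. is_cycle T xs)"

definition spanning_tree :: "'v ugraph \<Rightarrow> 'v ugraph \<Rightarrow> bool" where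
  "spanning_tree G T \<longleftrightarrow> is_tree T \<and> verts T = verts G \<and> edges T \<subseteq> edges G"

definition component_sets :: "'v ugraph \<Rightarrow> 'v set set" where
  "component_sets G = (\<lambda>u. {v \<in> verts G. (adj G)\<^sup>*\<^sup>* u v}) ` verts G"

definition delete_edge :: "'v ugraph \<Rightarrow> 'v set \<Rightarrow> 'v ugraph" where
  "delete_edge G e = G\<lparr>edges := edges G - {e}\<rparr>"

definition induced :: "'v ugraph \<Rightarrow> 'v set \<Rightarrow> 'v ugraph" where
  "induced G V = \<lparr>verts = V, edges = {e \<in> edges G. e \<subseteq> V}\<rparr>"

definition biclique_subgraph :: "'v ugraph \<Rightarrow> 'v set \<Rightarrow> 'v set \<Rightarrow> bool" where
  "biclique_subgraph G A B \<longleftrightarrow> A \<subseteq> verts G \<and> B \<subseteq> verts G \<and> A \<inter> B = {} \<and>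
     (\<forall>a\<in>A. \<forall>b\<in>B. {a, b} \<in> edges G)"

text \<open>A biclique is the unordered pair \<open>{A, B}\<close> of its parts.\<close>

definition biclique_cover :: "'v ugraph \<Rightarrow> 'v set set set \<Rightarrow> bool" where
  "biclique_cover G BC \<longleftrightarrow>
     (\<forall>P\<in>BC. \<exists>A B. P = {A, B} \<and> biclique_subgraph G A B) \<and>
     (\<forall>e\<in>edges G. \<exists>A B. {A, B} \<in> BC \<and> (\<exists>a\<in>A. \<exists>b\<in>B. e = {a, b}))"


section \<open>Combinatorial disjunctive constraints\<close>

text \<open>Vectors of \<open>\<real>\<^sup>J\<close> are functions on the whole type that vanish outside \<open>J\<close>.\<close>

definition simplex_on :: "'a set \<Rightarrow> ('a \<Rightarrow> real) set" where
  "simplex_on J = {l. (\<forall>v\<in>J. 0 \<le> l v) \<and> (\<forall>v. v \<notin> J \<longrightarrow> l v = 0) \<and> (\<Sum>v\<in>J. l v) = 1}"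

definition face_on :: "'a set \<Rightarrow> 'a set \<Rightarrow> ('a \<Rightarrow> real) set" where
  "face_on J S = {l \<in> simplex_on J. \<forall>v\<in>J - S. l v = 0}"

definition CDC :: "'a set set \<Rightarrow> ('a \<Rightarrow> real) set" where
  "CDC \<S> = (\<Union>S\<in>\<S>. face_on (\<Union>\<S>) S)"

definition conflict_graph :: "'a set set \<Rightarrow> 'a ugraph" where
  "conflict_graph \<S> = \<lparr>verts = \<Union>\<S>,
     edges = {{u, v} | u v. u \<in> \<Union>\<S> \<and> v \<in> \<Union>\<S> \<and> u \<noteq> v \<and> (\<forall>S\<in>\<S>. \<not> {u, v} \<subseteq> S)}\<rparr>"

definition intersection_graph :: "'a set set \<Rightarrow> 'a set ugraph" where
  "intersection_graph \<S> = \<lparr>verts = \<S>, edges = all_pairs \<S>\<rparr>"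

text \<open>For an edge \<open>e = {S, S'}\<close> this is \<open>S \<inter> S'\<close>.\<close>

definition mid :: "'a set set \<Rightarrow> 'a set" where
  "mid e = \<Inter>e"

definition weight :: "'a set ugraph \<Rightarrow> nat" where
  "weight T = (\<Sum>e\<in>edges T. card (mid e))"

definition max_spanning_tree :: "'a set set \<Rightarrow> 'a set ugraph \<Rightarrow> bool" where
  "max_spanning_tree \<S> T \<longleftrightarrow> spanning_tree (intersection_graph \<S>) T \<and>
     (\<forall>T'. spanning_tree (intersection_graph \<S>) T' \<longrightarrow> weight T' \<le> weight T)"


section \<open>The reformulation algorithm\<close>

text \<open>The algorithms leave several choices open (new indices, spanning tree, tree edge), so they are
  relations between inputs and possible outputs. The sets \<open>S'\<^sup>i\<close> are indexed by the sets
  \<open>S\<^sup>i\<close> themselves: \<open>P S\<close> is the current copy of \<open>S\<close>.\<close>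

text \<open>Each \<open>y \<in> Y\<close> is replaced by the \<open>x \<in> X\<close> with \<open>\<alpha> x = \<alpha> y\<close>, if there is one.\<close>

definition identify :: "('b \<Rightarrow> 'a) \<Rightarrow> 'b set \<Rightarrow> 'b set \<Rightarrow> 'b set" where
  "identify \<alpha> X Y = {x \<in> X. \<exists>y\<in>Y. \<alpha> x = \<alpha> y} \<union> {y \<in> Y. \<forall>x\<in>X. \<alpha> x \<noteq> \<alpha> y}"

text \<open>\<open>reform_state \<alpha> T P\<^sub>0 select P\<close>: the loop, started with the copies \<open>P\<^sub>0\<close>, can reach the
  selection \<open>select\<close> with current copies \<open>P\<close>. Any set may play the role of \<open>S\<^sup>1\<close>, since the numbering
  of the collection is arbitrary.\<close>

inductive reform_state ::
    "('b \<Rightarrow> 'a) \<Rightarrow> 'a set ugraph \<Rightarrow> ('a set \<Rightarrow> 'b set) \<Rightarrow> 'a set set \<Rightarrow> ('a set \<Rightarrow> 'b set) \<Rightarrow> bool"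
  for \<alpha> T P\<^sub>0 where
  start: "S1 \<in> verts T \<Longrightarrow> reform_state \<alpha> T P\<^sub>0 {S1} P\<^sub>0"
| select: "\<lbrakk>reform_state \<alpha> T P\<^sub>0 select P; {Si, Sj} \<in> edges T; Si \<in> select; Sj \<notin> select\<rbrakk>
    \<Longrightarrow> reform_state \<alpha> T P\<^sub>0 (insert Sj select) (P(Sj := identify \<alpha> (P Si) (P Sj)))"

definition reformulation ::
    "'a set set \<Rightarrow> 'b set set \<Rightarrow> ('b \<Rightarrow> 'a) \<Rightarrow> 'b set ugraph \<Rightarrow> bool" where
  "reformulation \<S> \<S>' \<alpha> T' \<longleftrightarrow> (\<exists>P\<^sub>0 \<alpha>\<^sub>0 T P.
     disjoint_family_on P\<^sub>0 \<S> \<and> (\<forall>S\<in>\<S>. bij_betw \<alpha>\<^sub>0 (P\<^sub>0 S) S) \<and>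
     max_spanning_tree \<S> T \<and>
     reform_state \<alpha>\<^sub>0 T P\<^sub>0 \<S> P \<and>
     \<S>' = P ` \<S> \<and>
     \<alpha> = restrict \<alpha>\<^sub>0 (\<Union>\<S>') \<and>
     T' = \<lparr>verts = \<S>', edges = (image P) ` edges T\<rparr>)"


section \<open>The biclique cover algorithm on a tree\<close>

definition splits :: "'v ugraph \<Rightarrow> 'v set \<Rightarrow> 'v set \<Rightarrow> 'v set \<Rightarrow> bool" where
  "splits T e V1 V2 \<longleftrightarrow> e \<in> edges T \<and> V1 \<noteq> V2 \<and> component_sets (delete_edge T e) = {V1, V2}"

definition imbalance :: "'v set \<Rightarrow> 'v set \<Rightarrow> int" where
  "imbalance V1 V2 = \<bar>int (card V1) - int (card V2)\<bar>"

inductive separation :: "'b set ugraph \<Rightarrow> ('b set \<times> 'b set) list \<Rightarrow> bool" where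
  trivial: "card (verts T) \<le> 1 \<Longrightarrow> separation T []"
| separate: "\<lbrakk>1 < card (verts T); splits T e V1 V2;
     \<And>f W1 W2. splits T f W1 W2 \<Longrightarrow> imbalance V1 V2 \<le> imbalance W1 W2;
     separation (induced T V1) bc1; separation (induced T V2) bc2\<rbrakk>
    \<Longrightarrow> separation T ((\<Union>V1 - mid e, \<Union>V2 - mid e)
          # take 1 bc1 @ take 1 bc2 @ drop 1 bc1 @ drop 1 bc2)"

fun merge_one :: "'b ugraph \<Rightarrow> 'b set \<times> 'b set \<Rightarrow> ('b set \<times> 'b set) list \<Rightarrow> ('b set \<times> 'b set) list"
where
  "merge_one G (A, B) [] = [(A, B)]"
| "merge_one G (A, B) ((A', B') # ms) =
     (if biclique_subgraph G (A' \<union> A) (B' \<union> B) then (A' \<union> A, B' \<union> B) # ms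
      else if biclique_subgraph G (A' \<union> B) (B' \<union> A) then (A' \<union> B, B' \<union> A) # ms
      else (A', B') # merge_one G (A, B) ms)"

definition merge_bicliques :: "'b ugraph \<Rightarrow> ('b set \<times> 'b set) list \<Rightarrow> ('b set \<times> 'b set) list" where
  "merge_bicliques G bcs = fold (merge_one G) bcs []"

definition biclique_cover_algorithm ::
    "'b set set \<Rightarrow> 'b set ugraph \<Rightarrow> 'b set set set \<Rightarrow> bool" where
  "biclique_cover_algorithm \<S>' T' BC \<longleftrightarrow> (\<exists>bcs. separation T' bcs \<and>
     BC = (\<lambda>(A, B). {A, B}) ` set (merge_bicliques (conflict_graph \<S>') bcs))"


section \<open>Mixed-binary linear systems and ideal formulations\<close>

text \<open>The pointwise vector space structure, which makes the library's \<^const>\<open>extreme_point_of\<close>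
  available for functions.\<close>

instantiation "fun" :: (type, real_vector) real_vector
begin

definition scaleR_fun :: "real \<Rightarrow> ('a \<Rightarrow> 'b) \<Rightarrow> 'a \<Rightarrow> 'b" where
  "scaleR_fun r f = (\<lambda>x. r *\<^sub>R f x)"

instance
  by standard (auto simp: scaleR_fun_def fun_eq_iff plus_fun_def scaleR_add_right scaleR_add_left)

end

text \<open>A constraint is a pair \<open>(c, b)\<close> of coefficients and right-hand side. Variable bounds
  (nonnegativity, and \<open>0 \<le> x \<le> 1\<close> for the relaxed binaries) are kept apart from \<open>inequalities\<close>.\<close>

record 'x system =
  variables :: "'x set"
  equations :: "(('x \<Rightarrow> real) \<times> real) set"
  inequalities :: "(('x \<Rightarrow> real) \<times> real) set"
  nonneg_vars :: "'x set"
  binary_vars :: "'x set"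

definition lhs :: "'x system \<Rightarrow> ('x \<Rightarrow> real) \<Rightarrow> ('x \<Rightarrow> real) \<Rightarrow> real" where
  "lhs M c p = (\<Sum>x\<in>variables M. c x * p x)"

definition lp_relaxation :: "'x system \<Rightarrow> ('x \<Rightarrow> real) set" where
  "lp_relaxation M = {p. (\<forall>x. x \<notin> variables M \<longrightarrow> p x = 0) \<and>
     (\<forall>(c, b)\<in>equations M. lhs M c p = b) \<and>
     (\<forall>(c, b)\<in>inequalities M. lhs M c p \<le> b) \<and>
     (\<forall>x\<in>nonneg_vars M. 0 \<le> p x) \<and>
     (\<forall>x\<in>binary_vars M. 0 \<le> p x \<and> p x \<le> 1)}"

definition integral_point :: "'x system \<Rightarrow> ('x \<Rightarrow> real) \<Rightarrow> bool" where
  "integral_point M p \<longleftrightarrow> (\<forall>x\<in>binary_vars M. p x \<in> {0, 1})"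

definition feasible_set :: "'x system \<Rightarrow> ('x \<Rightarrow> real) set" where
  "feasible_set M = {p \<in> lp_relaxation M. integral_point M p}"

definition continuous_vars :: "'x system \<Rightarrow> 'x set" where
  "continuous_vars M = variables M - binary_vars M"

datatype ('a, 'b) var = Lam 'a | Lam' 'b | Z nat

definition formulation :: "('a, 'b) var system \<Rightarrow> 'a set set \<Rightarrow> bool" where
  "formulation M \<S> \<longleftrightarrow> (\<lambda>p v. p (Lam v)) ` feasible_set M = CDC \<S>"

definition ideal_formulation :: "('a, 'b) var system \<Rightarrow> 'a set set \<Rightarrow> bool" where
  "ideal_formulation M \<S> \<longleftrightarrow> formulation M \<S> \<and>
     (\<forall>p. p extreme_point_of lp_relaxation M \<longrightarrow> integral_point M p)"

text \<open>\<open>\<lambda>\<^sub>v - (\<Sum>u | \<alpha> u = v. \<lambda>'\<^sub>u) = 0\<close>; here and below, \<open>u\<close> ranges over the variables of the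
  system, that is, over \<open>J'\<close>.\<close>

definition link_eq :: "('b \<Rightarrow> 'a) \<Rightarrow> 'a \<Rightarrow> (('a, 'b) var \<Rightarrow> real) \<times> real" where
  "link_eq \<alpha> v = ((\<lambda>x. case x of Lam w \<Rightarrow> if w = v then 1 else 0
                          | Lam' u \<Rightarrow> if \<alpha> u = v then - 1 else 0
                          | Z i \<Rightarrow> 0), 0)"

text \<open>\<open>(\<Sum>u. \<lambda>'\<^sub>u) = 1\<close>\<close>

definition simplex_eq :: "(('a, 'b) var \<Rightarrow> real) \<times> real" where
  "simplex_eq = ((\<lambda>x. case x of Lam w \<Rightarrow> 0 | Lam' u \<Rightarrow> 1 | Z i \<Rightarrow> 0), 1)"

text \<open>\<open>(\<Sum>u\<in>A. \<lambda>'\<^sub>u) - z\<^sub>j \<le> 0\<close> and \<open>(\<Sum>u\<in>B. \<lambda>'\<^sub>u) + z\<^sub>j \<le> 1\<close>\<close>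

definition left_ineq :: "'b set \<Rightarrow> nat \<Rightarrow> (('a, 'b) var \<Rightarrow> real) \<times> real" where
  "left_ineq A j = ((\<lambda>x. case x of Lam w \<Rightarrow> 0
                          | Lam' u \<Rightarrow> if u \<in> A then 1 else 0
                          | Z i \<Rightarrow> if i = j then - 1 else 0), 0)"

definition right_ineq :: "'b set \<Rightarrow> nat \<Rightarrow> (('a, 'b) var \<Rightarrow> real) \<times> real" where
  "right_ineq B j = ((\<lambda>x. case x of Lam w \<Rightarrow> 0
                          | Lam' u \<Rightarrow> if u \<in> B then 1 else 0
                          | Z i \<Rightarrow> if i = j then 1 else 0), 1)"

definition biclique_system ::
    "'a set \<Rightarrow> 'b set \<Rightarrow> ('b \<Rightarrow> 'a) \<Rightarrow> nat \<Rightarrow> (nat \<Rightarrow> 'b set) \<Rightarrow> (nat \<Rightarrow> 'b set) \<Rightarrow> ('a, 'b) var system"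
where
  "biclique_system J J' \<alpha> t A B =
     \<lparr>variables = Lam ` J \<union> Lam' ` J' \<union> Z ` {1..t},
      equations = insert simplex_eq (link_eq \<alpha> ` J),
      inequalities = (\<lambda>j. left_ineq (A j) j) ` {1..t} \<union> (\<lambda>j. right_ineq (B j) j) ` {1..t},
      nonneg_vars = Lam' ` J',
      binary_vars = Z ` {1..t}\<rparr>"

text \<open>Projecting out \<open>\<lambda>\<close>: each \<open>\<lambda>\<^sub>v\<close> is free and occurs only in the equation defining it, so
  substituting for it deletes the variable and that equation and leaves everything else unchanged
  (see \<open>lp_relaxation_project_out_Lam\<close> below).\<close>

definition project_out_Lam :: "('a, 'b) var system \<Rightarrow> ('a, 'b) var system" where
  "project_out_Lam M = M\<lparr>variables := variables M - range Lam,
     equations := {(c, b) \<in> equations M. \<forall>v. c (Lam v) = 0}\<rparr>"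

definition forget_Lam :: "(('a, 'b) var \<Rightarrow> real) \<Rightarrow> ('a, 'b) var \<Rightarrow> real" where
  "forget_Lam p = (\<lambda>x. case x of Lam v \<Rightarrow> 0 | _ \<Rightarrow> p x)"

text \<open>Sums over the variables of the system split into the three families.\<close>

lemma sum_three_families:
  fixes f :: "('a, 'b) var \<Rightarrow> real"
  assumes "finite J" "finite J'"
  shows "sum f (Lam ` J \<union> Lam' ` J' \<union> Z ` {1..t}) =
    (\<Sum>v\<in>J. f (Lam v)) + (\<Sum>u\<in>J'. f (Lam' u)) + (\<Sum>i\<in>{1..t}. f (Z i))"
proof -
  have "sum f (Lam ` J \<union> Lam' ` J' \<union> Z ` {1..t}) =
      sum f (Lam ` J) + sum f (Lam' ` J') + sum f (Z ` {1..t})"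
    using assms by (subst sum.union_disjoint; auto)+
  then show ?thesis
    by (simp add: sum.reindex inj_on_def)
qed

text \<open>The system in the displayed form.\<close>

lemma lp_relaxation_biclique_system:
  assumes J: "finite J" and J': "finite J'"
    and A: "\<And>j. j \<in> {1..t} \<Longrightarrow> A j \<subseteq> J'" and B: "\<And>j. j \<in> {1..t} \<Longrightarrow> B j \<subseteq> J'"
  shows "p \<in> lp_relaxation (biclique_system J J' \<alpha> t A B) \<longleftrightarrow>
    (\<forall>v. v \<notin> J \<longrightarrow> p (Lam v) = 0) \<and> (\<forall>i. i \<notin> {1..t} \<longrightarrow> p (Z i) = 0) \<and>
    (\<forall>v\<in>J. p (Lam v) = (\<Sum>u\<in>{u \<in> J'. \<alpha> u = v}. p (Lam' u))) \<and>
    (\<forall>j\<in>{1..t}. (\<Sum>u\<in>A j. p (Lam' u)) \<le> p (Z j)) \<and>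
    (\<forall>j\<in>{1..t}. (\<Sum>u\<in>B j. p (Lam' u)) \<le> 1 - p (Z j)) \<and>
    (\<forall>j\<in>{1..t}. 0 \<le> p (Z j) \<and> p (Z j) \<le> 1) \<and>
    (\<lambda>u. p (Lam' u)) \<in> simplex_on J'"
proof -
  let ?M = "biclique_system J J' \<alpha> t A B"
  have if_mult: "(if P then c else 0) * x = (if P then c * x else 0)" for P and c x :: real
    by simp
  have lhs_M: "lhs ?M c p = (\<Sum>v\<in>J. c (Lam v) * p (Lam v)) + (\<Sum>u\<in>J'. c (Lam' u) * p (Lam' u))
      + (\<Sum>i\<in>{1..t}. c (Z i) * p (Z i))" for c
    unfolding lhs_def biclique_system_def using sum_three_families[OF J J'] by simp
  have link: "lhs ?M (fst (link_eq \<alpha> v)) p = snd (link_eq \<alpha> v) \<longleftrightarrow>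
      p (Lam v) = (\<Sum>u\<in>{u \<in> J'. \<alpha> u = v}. p (Lam' u))" if "v \<in> J" for v
    using that J J' unfolding lhs_M link_eq_def
    by (simp add: if_mult sum.delta sum.If_cases sum_negf Int_def)
  have simplex: "lhs ?M (fst simplex_eq) p = snd (simplex_eq :: (('a, 'b) var \<Rightarrow> real) \<times> real) \<longleftrightarrow>
      (\<Sum>u\<in>J'. p (Lam' u)) = 1"
    unfolding lhs_M simplex_eq_def by simp
  have left: "lhs ?M (fst (left_ineq (A j) j)) p \<le> snd (left_ineq (A j) j :: (('a, 'b) var \<Rightarrow> real) \<times> real) \<longleftrightarrow>
      (\<Sum>u\<in>A j. p (Lam' u)) \<le> p (Z j)" if "j \<in> {1..t}" for j
    using that J' A[OF that] unfolding lhs_M left_ineq_def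
    by (simp add: if_mult sum.delta sum.If_cases Int_absorb1)
  have right: "lhs ?M (fst (right_ineq (B j) j)) p \<le> snd (right_ineq (B j) j :: (('a, 'b) var \<Rightarrow> real) \<times> real) \<longleftrightarrow>
      (\<Sum>u\<in>B j. p (Lam' u)) \<le> 1 - p (Z j)" if "j \<in> {1..t}" for j
    using that J' B[OF that] unfolding lhs_M right_ineq_def
    by (simp add: if_mult sum.delta sum.If_cases Int_absorb1 le_diff_eq)
  have support: "(\<forall>x. x \<notin> variables ?M \<longrightarrow> p x = 0) \<longleftrightarrow>
      (\<forall>v. v \<notin> J \<longrightarrow> p (Lam v) = 0) \<and> (\<forall>u. u \<notin> J' \<longrightarrow> p (Lam' u) = 0) \<and>
      (\<forall>i. i \<notin> {1..t} \<longrightarrow> p (Z i) = 0)"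
  proof
    assume "\<forall>x. x \<notin> variables ?M \<longrightarrow> p x = 0"
    then show "(\<forall>v. v \<notin> J \<longrightarrow> p (Lam v) = 0) \<and> (\<forall>u. u \<notin> J' \<longrightarrow> p (Lam' u) = 0) \<and>
      (\<forall>i. i \<notin> {1..t} \<longrightarrow> p (Z i) = 0)"
      by (auto simp: biclique_system_def image_iff)
  next
    assume *: "(\<forall>v. v \<notin> J \<longrightarrow> p (Lam v) = 0) \<and> (\<forall>u. u \<notin> J' \<longrightarrow> p (Lam' u) = 0) \<and>
      (\<forall>i. i \<notin> {1..t} \<longrightarrow> p (Z i) = 0)"
    show "\<forall>x. x \<notin> variables ?M \<longrightarrow> p x = 0"
    proof (intro allI impI)
      fix x assume "x \<notin> variables ?M"
      then show "p x = 0"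
        using * by (cases x) (auto simp: biclique_system_def image_iff)
    qed
  qed
  have eqs: "(\<forall>(c, b)\<in>equations ?M. lhs ?M c p = b) \<longleftrightarrow>
      (\<Sum>u\<in>J'. p (Lam' u)) = 1 \<and> (\<forall>v\<in>J. p (Lam v) = (\<Sum>u\<in>{u \<in> J'. \<alpha> u = v}. p (Lam' u)))"
  proof -
    have "equations ?M = insert simplex_eq (link_eq \<alpha> ` J)"
      by (simp add: biclique_system_def)
    then show ?thesis
      using simplex link by (simp add: case_prod_beta)
  qed
  have ineqs: "(\<forall>(c, b)\<in>inequalities ?M. lhs ?M c p \<le> b) \<longleftrightarrow>
      (\<forall>j\<in>{1..t}. (\<Sum>u\<in>A j. p (Lam' u)) \<le> p (Z j)) \<and>
      (\<forall>j\<in>{1..t}. (\<Sum>u\<in>B j. p (Lam' u)) \<le> 1 - p (Z j))"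
  proof -
    have "inequalities ?M = (\<lambda>j. left_ineq (A j) j) ` {1..t} \<union> (\<lambda>j. right_ineq (B j) j) ` {1..t}"
      by (simp add: biclique_system_def)
    then show ?thesis
      using left right by (simp add: case_prod_beta ball_Un del: atLeastAtMost_iff)
  qed
  have "nonneg_vars ?M = Lam' ` J'" "binary_vars ?M = Z ` {1..t}"
    by (simp_all add: biclique_system_def)
  then show ?thesis
    unfolding lp_relaxation_def simplex_on_def mem_Collect_eq support eqs ineqs by auto
qed

lemma lp_relaxation_project_out_Lam:
  assumes J: "finite J" and J': "finite J'"
  shows "lp_relaxation (project_out_Lam (biclique_system J J' \<alpha> t A B)) =
           forget_Lam ` lp_relaxation (biclique_system J J' \<alpha> t A B)"
proof -
  let ?M = "biclique_system J J' \<alpha> t A B"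
  let ?N = "project_out_Lam ?M"
  have if_mult: "(if P then c else 0) * x = (if P then c * x else 0)" for P and c x :: real
    by simp
  have lhs_M: "lhs ?M c p = (\<Sum>v\<in>J. c (Lam v) * p (Lam v)) + (\<Sum>u\<in>J'. c (Lam' u) * p (Lam' u))
      + (\<Sum>i\<in>{1..t}. c (Z i) * p (Z i))" for c p
    unfolding lhs_def biclique_system_def using sum_three_families[OF J J'] by simp
  have vars_M: "variables ?M = Lam ` J \<union> Lam' ` J' \<union> Z ` {1..t}"
    by (simp add: biclique_system_def)
  have vars_N: "variables ?N = Lam ` {} \<union> Lam' ` J' \<union> Z ` {1..t}"
    by (auto simp: project_out_Lam_def biclique_system_def)
  have lhs_N: "lhs ?N c p = (\<Sum>u\<in>J'. c (Lam' u) * p (Lam' u)) + (\<Sum>i\<in>{1..t}. c (Z i) * p (Z i))"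
    for c p
    unfolding lhs_def vars_N by (subst sum_three_families) (use J' in auto)
  have "fst (link_eq \<alpha> v) (Lam v) = 1" for v
    by (simp add: link_eq_def)
  then have "(c, b) \<noteq> link_eq \<alpha> v" if "\<forall>v. c (Lam v) = 0" for c b v
    using that by (metis fst_conv zero_neq_one)
  then have eqs_N: "equations ?N = {simplex_eq}"
    by (auto simp: project_out_Lam_def biclique_system_def simplex_eq_def)
  have eqs_M: "equations ?M = insert simplex_eq (link_eq \<alpha> ` J)"
    by (simp add: biclique_system_def)
  have rest: "inequalities ?N = inequalities ?M" "nonneg_vars ?N = nonneg_vars ?M"
    "binary_vars ?N = binary_vars ?M"
    by (simp_all add: project_out_Lam_def)
  have no_Lam: "c (Lam v) = 0" if "(c, b) \<in> insert simplex_eq (inequalities ?M)" for c b v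
    using that by (auto simp: biclique_system_def simplex_eq_def left_ineq_def right_ineq_def)
  have lhs_eq: "lhs ?N c (forget_Lam p) = lhs ?M c p"
    if "(c, b) \<in> insert simplex_eq (inequalities ?M)" for c b p
    using no_Lam[OF that] unfolding lhs_N lhs_M forget_Lam_def by simp
  have bounded: "x \<in> nonneg_vars ?M \<union> binary_vars ?M \<Longrightarrow> forget_Lam p x = p x" for x p
    by (auto simp: biclique_system_def forget_Lam_def)
  have sub: "forget_Lam p \<in> lp_relaxation ?N" if p: "p \<in> lp_relaxation ?M" for p
  proof -
    have "forget_Lam p x = 0" if "x \<notin> variables ?N" for x
    proof (cases x)
      case (Lam' u)
      then have "x \<notin> variables ?M" using that by (auto simp: vars_N vars_M image_iff)
      then show ?thesis using p Lam' by (simp add: lp_relaxation_def forget_Lam_def)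
    next
      case (Z i)
      then have "x \<notin> variables ?M" using that by (auto simp: vars_N vars_M image_iff)
      then show ?thesis using p Z by (simp add: lp_relaxation_def forget_Lam_def)
    qed (simp add: forget_Lam_def)
    moreover have "lhs ?N c (forget_Lam p) = b" if "(c, b) \<in> equations ?N" for c b
    proof -
      have "(c, b) \<in> equations ?M" and mem: "(c, b) \<in> insert simplex_eq (inequalities ?M)"
        using that eqs_N eqs_M by auto
      then have "lhs ?M c p = b" using p by (auto simp: lp_relaxation_def)
      then show ?thesis using lhs_eq[OF mem] by simp
    qed
    moreover have "lhs ?N c (forget_Lam p) \<le> b" if "(c, b) \<in> inequalities ?N" for c b
      using that p lhs_eq[of c b p] unfolding lp_relaxation_def rest by auto
    ultimately show ?thesis
      using p bounded[of _ p] unfolding lp_relaxation_def rest by (auto simp del: atLeastAtMost_iff)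
  qed
  have sup: "q \<in> forget_Lam ` lp_relaxation ?M" if q: "q \<in> lp_relaxation ?N" for q
  proof
    define p where "p = (\<lambda>x. case x of
        Lam v \<Rightarrow> if v \<in> J then \<Sum>u\<in>{u \<in> J'. \<alpha> u = v}. q (Lam' u) else 0 | _ \<Rightarrow> q x)"
    have q0: "q x = 0" if "x \<notin> variables ?N" for x
      using q that by (simp add: lp_relaxation_def)
    show qp: "q = forget_Lam p"
    proof
      fix x show "q x = forget_Lam p x"
        using q0[of x] by (cases x) (auto simp: forget_Lam_def p_def vars_N)
    qed
    have "p x = 0" if "x \<notin> variables ?M" for x
      using that q0[of x] by (cases x) (auto simp: p_def vars_N vars_M image_iff)
    moreover have "lhs ?M c p = b" if "(c, b) \<in> equations ?M" for c b
    proof (cases "(c, b) = simplex_eq")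
      case True
      then have "(c, b) \<in> equations ?N" using eqs_N by simp
      then have "lhs ?N c q = b" using q by (auto simp: lp_relaxation_def)
      then show ?thesis using lhs_eq[of c b p] True qp by simp
    next
      case False
      then obtain v where "v \<in> J" "(c, b) = link_eq \<alpha> v" using \<open>(c, b) \<in> equations ?M\<close> eqs_M by auto
      then show ?thesis
        using J J' unfolding lhs_M link_eq_def p_def
        by (simp add: if_mult sum.delta sum.If_cases sum_negf Int_def)
    qed
    moreover have "lhs ?M c p \<le> b" if "(c, b) \<in> inequalities ?M" for c b
      using that q lhs_eq[of c b p] qp unfolding lp_relaxation_def rest by auto
    ultimately show "p \<in> lp_relaxation ?M"
      using q bounded[of _ p] qp unfolding lp_relaxation_def rest by (auto simp del: atLeastAtMost_iff)
  qed
  show ?thesis using sub sup by blast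
qed

end

theory Submission
  imports Defs
begin

text \<open>
  Each new copy meets the union of the earlier ones exactly in its intersection with the copy it is
  attached to. Hence the
  tree vertices containing a given index are connected (running intersection), pairwise compatible
  indices lie in a common set, and the number of indices is that of a disjoint union minus the tree
  weight. Running intersection makes every edge split of the tree a biclique of the conflict graph,
  and compatibility being pairwise makes a cover of the conflict edges describe the disjunction.
  The relaxation is integral for any family of disjoint pairs \<open>A\<^sub>j, B\<^sub>j\<close>: an index with
  fractional \<open>\<lambda>'\<close> can be split off as a unit vector with suitable \<open>z\<close>, and at a unit vector the
  feasible \<open>z\<close> form a face of the cube.
\<close>

section \<open>Bridges\<close>

text \<open>Acyclicity is used only in the form that every edge is a bridge. Being a statement about
  reachability, it can be carried along the injective map from sets to copies, and it can be applied
  to the whole tree while the cover algorithm recurses into subtrees. The latter matters because a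
  biclique found in a subtree must be one for the conflict graph of the whole family: the two sides
  of a split have to stay apart in the whole tree, where running intersection provides its paths.

  The obstacle that forces fresh copies is visible in the family \<open>{a,b}\<close>,
  \<open>{b,c}\<close>, \<open>{a,c}\<close>: its indices are pairwise compatible without lying in a
  common set, and along any spanning tree one index skips the middle vertex. After copying, that
  index has two preimages under \<open>\<alpha>\<close>, and both defects disappear.\<close>

definition all_bridges :: "'v ugraph \<Rightarrow> bool" where
  "all_bridges G \<longleftrightarrow> (\<forall>u v. {u, v} \<in> edges G \<longrightarrow> \<not> (adj (delete_edge G {u, v}))\<^sup>*\<^sup>* u v)"

lemma symp_adj: "symp (adj G)"
  by (simp add: symp_def adj_def insert_commute)

lemma adj_rtranclp_sym: "(adj G)\<^sup>*\<^sup>* u v \<Longrightarrow> (adj G)\<^sup>*\<^sup>* v u"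
  using symp_rtranclp[OF symp_adj] by (rule sympD)

lemma adj_rtranclp_mono:
  assumes "(adj G)\<^sup>*\<^sup>* u v" "edges G \<subseteq> edges H"
  shows "(adj H)\<^sup>*\<^sup>* u v"
  using assms(1) by (rule rtranclp_mono[THEN predicate2D, rotated]) (use assms(2) in \<open>auto simp: adj_def\<close>)

text \<open>Loops are removed while the path is built backwards: if the new start already lies on
  the simple path, the suffix beginning there is used instead.\<close>

lemma rtranclp_distinct_path:
  assumes "R\<^sup>*\<^sup>* u v"
  shows "\<exists>xs. xs \<noteq> [] \<and> hd xs = u \<and> last xs = v \<and> distinct xs \<and> successively R xs"
  using assms
proof (induction rule: converse_rtranclp_induct)
  case base
  then show ?case by (intro exI[of _ "[v]"]) simp
next
  case (step u y)
  then obtain xs where xs: "xs \<noteq> []" "hd xs = y" "last xs = v" "distinct xs" "successively R xs"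
    by blast
  show ?case
  proof (cases "u \<in> set xs")
    case True
    then obtain ys zs where "xs = ys @ u # zs" by (meson split_list)
    then show ?thesis
      using xs by (intro exI[of _ "u # zs"]) (auto simp: successively_append_iff)
  next
    case False
    then show ?thesis
      using xs step(1) by (intro exI[of _ "u # xs"]) (auto simp: successively_Cons)
  qed
qed

text \<open>A simple path around the edge closes with it to a cycle. It has at least three vertices,
  because the endpoints differ and a two-vertex path would be the edge itself.\<close>

lemma tree_all_bridges:
  assumes "is_tree T"
  shows "all_bridges T"
  unfolding all_bridges_def
proof (intro allI impI notI)
  fix u v
  assume e: "{u, v} \<in> edges T" and r: "(adj (delete_edge T {u, v}))\<^sup>*\<^sup>* u v"
  obtain xs where xs: "xs \<noteq> []" "hd xs = u" "last xs = v" "distinct xs"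
    "successively (adj (delete_edge T {u, v})) xs"
    using rtranclp_distinct_path[OF r] by blast
  have "edges T \<subseteq> all_pairs (verts T)"
    using assms by (simp add: is_tree_def is_ugraph_def)
  with e have "u \<noteq> v"
    by (auto simp: all_pairs_def doubleton_eq_iff)
  have step: "adj T (xs ! i) (xs ! Suc i)" "{xs ! i, xs ! Suc i} \<noteq> {u, v}" if "Suc i < length xs" for i
    using successively_nth[OF xs(5) that] by (auto simp: adj_def delete_edge_def)
  have hd0: "xs ! 0 = u" and lastn: "xs ! (length xs - 1) = v"
    using xs by (auto simp: hd_conv_nth last_conv_nth)
  have "length xs \<noteq> 1" "length xs \<noteq> 2"
    using \<open>u \<noteq> v\<close> hd0 lastn step(2)[of 0] by auto
  moreover have "length xs \<noteq> 0"
    using xs(1) by simp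
  ultimately have "3 \<le> length xs"
    by linarith
  moreover have "adj T (xs ! i) (xs ! (Suc i mod length xs))" if "i < length xs" for i
  proof (cases "Suc i < length xs")
    \<comment> \<open>The last index wraps around, and the closing step is the removed edge.\<close>
    case False
    then have "i = length xs - 1" "Suc i = length xs" using that by auto
    then have "xs ! i = v" "Suc i mod length xs = 0" using lastn by auto
    then show ?thesis using hd0 e by (simp add: adj_def insert_commute)
  qed (simp add: step)
  ultimately have "is_cycle T xs"
    using xs(4) by (simp add: is_cycle_def)
  then show False
    using assms by (auto simp: is_tree_def)
qed

section \<open>Components as a partition of the vertices\<close>

lemma component_sets_cover: "\<Union>(component_sets G) = verts G"
  by (auto simp: component_sets_def)

lemma component_sets_nonempty: "V \<in> component_sets G \<Longrightarrow> V \<noteq> {}"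
  by (auto simp: component_sets_def)

lemma component_sets_disjoint:
  assumes "V \<in> component_sets G" "W \<in> component_sets G" "V \<noteq> W"
  shows "V \<inter> W = {}"
proof (rule ccontr)
  assume "V \<inter> W \<noteq> {}"
  then obtain x where x: "x \<in> V" "x \<in> W" by blast
  obtain u v where uv: "V = {x \<in> verts G. (adj G)\<^sup>*\<^sup>* u x}" "W = {x \<in> verts G. (adj G)\<^sup>*\<^sup>* v x}"
    using assms by (auto simp: component_sets_def)
  have "(adj G)\<^sup>*\<^sup>* u v" "(adj G)\<^sup>*\<^sup>* v u"
    using x unfolding uv by (auto dest: adj_rtranclp_sym intro: rtranclp_trans)
  then have "V = W"
    unfolding uv by (auto intro: rtranclp_trans)
  with assms(3) show False ..
qed


section \<open>Gluing the copies along the tree\<close>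

text \<open>The junction tree property: for each \<open>x\<close>, the vertices containing
  \<open>x\<close> are linked by paths all of whose vertices contain \<open>x\<close>.\<close>

definition running_intersection :: "'b set ugraph \<Rightarrow> bool" where
  "running_intersection T \<longleftrightarrow> (\<forall>S\<in>verts T. \<forall>S'\<in>verts T. \<forall>x\<in>S \<inter> S'.
     (\<lambda>U W. adj T U W \<and> x \<in> U \<inter> W)\<^sup>*\<^sup>* S S')"

text \<open>In hypergraph terms this is conformality. It will be applied to the support of a
  feasible \<lambda>'.\<close>

definition clique_helly :: "'b set set \<Rightarrow> bool" where
  "clique_helly \<S> \<longleftrightarrow> (\<forall>K. (\<forall>u\<in>K. \<forall>v\<in>K. \<exists>S\<in>\<S>. {u, v} \<subseteq> S) \<longrightarrow> (\<exists>S\<in>\<S>. K \<subseteq> S))"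

text \<open>A replacement keeps the value of \<alpha>, so the image is unchanged. Two members with
  equal values cannot come one from \<open>X\<close> and one from the kept part of \<open>Y\<close>,
  since the latter consists of values that \<open>X\<close> misses.\<close>

lemma bij_betw_identify:
  assumes "inj_on \<alpha> X" "bij_betw \<alpha> Y S"
  shows "bij_betw \<alpha> (identify \<alpha> X Y) S"
  unfolding bij_betw_def
proof
  show "inj_on \<alpha> (identify \<alpha> X Y)"
    using assms unfolding bij_betw_def inj_on_def identify_def by auto
  have S: "S = \<alpha> ` Y"
    using assms(2) by (simp add: bij_betw_def)
  show "\<alpha> ` identify \<alpha> X Y = S"
  proof
    show "S \<subseteq> \<alpha> ` identify \<alpha> X Y"
    proof
      fix s assume "s \<in> S"
      then obtain y where y: "y \<in> Y" "s = \<alpha> y" using S by blast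
      show "s \<in> \<alpha> ` identify \<alpha> X Y"
      proof (cases "\<exists>x\<in>X. \<alpha> x = \<alpha> y")
        case True
        then obtain x where "x \<in> X" "\<alpha> x = \<alpha> y" by blast
        then have "x \<in> identify \<alpha> X Y" using y by (auto simp: identify_def)
        then show ?thesis using y \<open>\<alpha> x = \<alpha> y\<close> by (metis imageI)
      next
        case False
        then have "y \<in> identify \<alpha> X Y" using y by (auto simp: identify_def)
        then show ?thesis using y by blast
      qed
    qed
  qed (auto simp: S identify_def)
qed

locale gluing =
  fixes \<alpha> :: "'b \<Rightarrow> 'a" and T :: "'a set ugraph" and P\<^sub>0 :: "'a set \<Rightarrow> 'b set"
  assumes finite_verts: "finite (verts T)" and finite_sets: "\<And>S. S \<in> verts T \<Longrightarrow> finite S"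
    and edges_T: "edges T \<subseteq> all_pairs (verts T)"
    and bridges: "all_bridges T"
    and disjoint: "disjoint_family_on P\<^sub>0 (verts T)"
    and bij_P\<^sub>0: "\<And>S. S \<in> verts T \<Longrightarrow> bij_betw \<alpha> (P\<^sub>0 S) S"
begin

section \<open>Invariants of the selection loop\<close>

lemma edge_endpoints: "{u, v} \<in> edges T \<Longrightarrow> u \<in> verts T \<and> v \<in> verts T \<and> u \<noteq> v"
  using edges_T by (auto simp: all_pairs_def doubleton_eq_iff)

lemma select_verts: "reform_state \<alpha> T P\<^sub>0 V P \<Longrightarrow> V \<subseteq> verts T \<and> V \<noteq> {}"
  by (induction rule: reform_state.induct) (auto dest: edge_endpoints)

lemma finite_select: "reform_state \<alpha> T P\<^sub>0 V P \<Longrightarrow> finite V"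
  using select_verts finite_verts by (meson finite_subset)

lemma unselected: "reform_state \<alpha> T P\<^sub>0 V P \<Longrightarrow> S \<notin> V \<Longrightarrow> P S = P\<^sub>0 S"
  by (induction rule: reform_state.induct) auto

lemma bij_P: "reform_state \<alpha> T P\<^sub>0 V P \<Longrightarrow> S \<in> verts T \<Longrightarrow> bij_betw \<alpha> (P S) S"
proof (induction arbitrary: S rule: reform_state.induct)
  case (start S1)
  then show ?case by (simp add: bij_P\<^sub>0)
next
  case (select V P Si Sj)
  have "inj_on \<alpha> (P Si)" "bij_betw \<alpha> (P Sj) Sj"
    using select.IH edge_endpoints[OF select.hyps(2)] by (auto simp: bij_betw_def)
  then show ?case
    using select by (auto intro: bij_betw_identify)
qed

lemma finite_P: "reform_state \<alpha> T P\<^sub>0 V P \<Longrightarrow> S \<in> verts T \<Longrightarrow> finite (P S)"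
  using bij_P finite_sets bij_betw_finite by blast

text \<open>Replacements only bring in indices of an already selected copy. Hence the original copy
  of an unselected set is still disjoint from everything selected.\<close>

lemma selected_old_indices: "reform_state \<alpha> T P\<^sub>0 V P \<Longrightarrow> S \<in> V \<Longrightarrow> P S \<subseteq> \<Union>(P\<^sub>0 ` V)"
proof (induction arbitrary: S rule: reform_state.induct)
  case (start S1)
  then show ?case by simp
next
  case (select V P Si Sj)
  have "identify \<alpha> (P Si) (P Sj) \<subseteq> P Si \<union> P\<^sub>0 Sj"
    using unselected[OF select.hyps(1,4)] by (auto simp: identify_def)
  moreover have "P Si \<subseteq> \<Union>(P\<^sub>0 ` V)"
    by (rule select.IH[OF select.hyps(3)])
  ultimately have "identify \<alpha> (P Si) (P Sj) \<subseteq> \<Union>(P\<^sub>0 ` insert Sj V)"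
    by blast
  moreover have "P S \<subseteq> \<Union>(P\<^sub>0 ` insert Sj V)" if "S \<in> V"
    using select.IH[OF that] by blast
  ultimately show ?case
    using select.prems by (cases "S = Sj") simp_all
qed

text \<open>Until its turn \<open>Sj\<close> keeps its original copy, which shares nothing with the
  selected ones; so every index shared after gluing was taken over from \<open>P Si\<close>. All
  three invariants below rest on this.\<close>

lemma glue_Int:
  assumes "reform_state \<alpha> T P\<^sub>0 V P" "{Si, Sj} \<in> edges T" "Si \<in> V" "Sj \<notin> V"
  shows "identify \<alpha> (P Si) (P Sj) \<inter> \<Union>(P ` V) \<subseteq> P Si"
proof -
  have "P\<^sub>0 Sj \<inter> P\<^sub>0 S = {}" if "S \<in> V" for S
  proof (rule disjoint_family_onD[OF disjoint])
    show "Sj \<noteq> S" "Sj \<in> verts T" "S \<in> verts T"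
      using that assms(4) select_verts[OF assms(1)] edge_endpoints[OF assms(2)] by blast+
  qed
  then have "P Sj \<inter> P S = {}" if "S \<in> V" for S
    using that selected_old_indices[OF assms(1)] unselected[OF assms(1,4)] by fast
  then show ?thesis
    by (auto simp: identify_def)
qed

lemma select_connected:
  "reform_state \<alpha> T P\<^sub>0 V P \<Longrightarrow> u \<in> V \<Longrightarrow> v \<in> V \<Longrightarrow> (adj (induced T V))\<^sup>*\<^sup>* u v"
proof (induction arbitrary: u v rule: reform_state.induct)
  case (start S1)
  then show ?case by simp
next
  case (select V P Si Sj)
  let ?R = "(adj (induced T (insert Sj V)))\<^sup>*\<^sup>*"
  have old: "?R u v" if "u \<in> V" "v \<in> V" for u v
    by (rule adj_rtranclp_mono[OF select.IH[OF that]]) (auto simp: induced_def)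
  have "?R Si Sj"
    using select.hyps by (intro r_into_rtranclp) (auto simp: adj_def induced_def)
  then have to_Sj: "?R u Sj" if "u \<in> insert Sj V" for u
    using that old[of u Si] select.hyps(3) by (auto intro: rtranclp_trans)
  show ?case
    using to_Sj[OF select.prems(1)] adj_rtranclp_sym[OF to_Sj[OF select.prems(2)]]
    by (rule rtranclp_trans)
qed

text \<open>A second edge from \<open>Sj\<close> to some \<open>Sk\<close> in \<open>V\<close> would
  not be a bridge: it is bypassed by a path from \<open>Sk\<close> to \<open>Si\<close> inside
  \<open>V\<close> followed by the edge to \<open>Sj\<close>.\<close>

lemma edges_insert_select:
  assumes "reform_state \<alpha> T P\<^sub>0 V P" "{Si, Sj} \<in> edges T" "Si \<in> V" "Sj \<notin> V"
  shows "{e \<in> edges T. e \<subseteq> insert Sj V} = insert {Si, Sj} {e \<in> edges T. e \<subseteq> V}"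
proof -
  have "e = {Si, Sj}" if e: "e \<in> edges T" "e \<subseteq> insert Sj V" "\<not> e \<subseteq> V" for e
  proof (rule ccontr)
    assume ne: "e \<noteq> {Si, Sj}"
    obtain Sk where Sk: "e = {Sk, Sj}" "Sk \<in> V"
    proof -
      have "e \<in> all_pairs (verts T)" using e(1) edges_T by blast
      then obtain a b where ab: "e = {a, b}" "a \<noteq> b" by (auto simp: all_pairs_def)
      show thesis
      proof (cases "a = Sj")
        case True
        then show thesis using that[of b] ab e(2) by auto
      next
        case False
        then show thesis using that[of a] ab e(2,3) by auto
      qed
    qed
    have "(adj (delete_edge T {Sk, Sj}))\<^sup>*\<^sup>* Sk Si"
      using select_connected[OF assms(1) Sk(2) assms(3)]
      by (rule adj_rtranclp_mono) (use assms(4) in \<open>auto simp: induced_def delete_edge_def\<close>)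
    moreover have "adj (delete_edge T {Sk, Sj}) Si Sj"
      using assms(2) ne Sk(1) by (auto simp: adj_def delete_edge_def)
    ultimately have "(adj (delete_edge T {Sk, Sj}))\<^sup>*\<^sup>* Sk Sj"
      by (rule rtranclp.rtrancl_into_rtrancl)
    then show False
      using bridges e(1) Sk(1) by (auto simp: all_bridges_def)
  qed
  then have "{e \<in> edges T. e \<subseteq> insert Sj V} \<subseteq> insert {Si, Sj} {e \<in> edges T. e \<subseteq> V}"
    by blast
  moreover have "insert {Si, Sj} {e \<in> edges T. e \<subseteq> V} \<subseteq> {e \<in> edges T. e \<subseteq> insert Sj V}"
    using assms(2,3) by blast
  ultimately show ?thesis ..
qed

text \<open>The new copy overlaps the old union in its intersection with \<open>P Si\<close>, which
  is the \<open>mid\<close> of the only new edge, so inclusion-exclusion adds one matching term to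
  each side. The form without subtraction keeps the count within the natural numbers.\<close>

lemma card_indices:
  "reform_state \<alpha> T P\<^sub>0 V P \<Longrightarrow>
     (\<Sum>S\<in>V. card S) = card (\<Union>(P ` V)) + (\<Sum>e\<in>{e \<in> edges T. e \<subseteq> V}. card (\<Inter>(P ` e)))"
proof (induction rule: reform_state.induct)
  case (start S1)
  have no_edges: "{e \<in> edges T. e \<subseteq> {S1}} = {}"
    using edges_T by (auto simp: all_pairs_def)
  show ?case
    unfolding no_edges using bij_betw_same_card[OF bij_P\<^sub>0[OF start]] by simp
next
  case (select V P Si Sj)
  let ?N = "identify \<alpha> (P Si) (P Sj)" and ?U = "\<Union>(P ` V)"
  let ?P = "P(Sj := ?N)" and ?E = "{e \<in> edges T. e \<subseteq> V}"
  note state = reform_state.select[OF select.hyps]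
  have Sj: "Sj \<in> verts T"
    using edge_endpoints[OF select.hyps(2)] by simp
  have finV: "finite V" and finN: "finite ?N" and finU: "finite ?U"
    using finite_select[OF select.hyps(1)] finite_P[OF state Sj] finite_P[OF select.hyps(1)]
      select_verts[OF select.hyps(1)] by auto
  have "edges T \<subseteq> Pow (verts T)"
    using edges_T by (auto simp: all_pairs_def)
  then have finE: "finite ?E"
    using finite_verts by (auto intro: finite_subset)
  have PV: "\<Union>(?P ` insert Sj V) = ?N \<union> ?U"
    using select.hyps(4) by (auto split: if_splits)
  have "?N \<inter> ?U = ?N \<inter> P Si"
    using glue_Int[OF select.hyps] select.hyps(3) by blast
  then have mid_new: "card (\<Inter>(?P ` {Si, Sj})) = card (?N \<inter> ?U)"
    using edge_endpoints[OF select.hyps(2)] by (simp add: Int_commute)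
  have mid_old: "card (\<Inter>(?P ` e)) = card (\<Inter>(P ` e))" if "e \<in> ?E" for e
  proof -
    have "?P ` e = P ` e"
      using that select.hyps(4) by (intro image_cong) auto
    then show ?thesis by simp
  qed
  have "(\<Sum>S\<in>insert Sj V. card S) = card ?N + (\<Sum>S\<in>V. card S)"
    using finV select.hyps(4) bij_betw_same_card[OF bij_P[OF state Sj]] by simp
  also have "\<dots> = card ?N + card ?U + (\<Sum>e\<in>?E. card (\<Inter>(P ` e)))"
    using select.IH by simp
  also have "\<dots> = card (?N \<union> ?U) + card (?N \<inter> ?U) + (\<Sum>e\<in>?E. card (\<Inter>(P ` e)))"
    using card_Un_Int[OF finN finU] by simp
  also have "(\<Sum>e\<in>?E. card (\<Inter>(P ` e))) = (\<Sum>e\<in>?E. card (\<Inter>(?P ` e)))"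
    by (rule sum.cong[OF refl mid_old[symmetric]])
  also have "card (?N \<union> ?U) + card (?N \<inter> ?U) + \<dots> =
      card (?N \<union> ?U) + card (\<Inter>(?P ` {Si, Sj})) + \<dots>"
    unfolding mid_new ..
  also have "\<dots> = card (?N \<union> ?U) + (\<Sum>e\<in>insert {Si, Sj} ?E. card (\<Inter>(?P ` e)))"
    using finE select.hyps(4) by (subst sum.insert) auto
  finally show ?case
    unfolding PV edges_insert_select[OF select.hyps] .
qed

text \<open>If \<open>K\<close> contains an index that no old copy has, every partner of that index
  shares the new copy with it. Otherwise a pair that is compatible through the new copy already lies
  in \<open>P Si\<close>, so the old family realises all pairs of \<open>K\<close>.\<close>

lemma clique_helly_P: "reform_state \<alpha> T P\<^sub>0 V P \<Longrightarrow> clique_helly (P ` V)"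
proof (induction rule: reform_state.induct)
  case (start S1)
  then show ?case by (auto simp: clique_helly_def)
next
  case (select V P Si Sj)
  let ?N = "identify \<alpha> (P Si) (P Sj)"
  have PV: "P(Sj := ?N) ` insert Sj V = insert ?N (P ` V)"
    using select.hyps(4) by auto
  show ?case
    unfolding PV clique_helly_def
  proof (intro allI impI)
    fix K assume K: "\<forall>u\<in>K. \<forall>v\<in>K. \<exists>S\<in>insert ?N (P ` V). {u, v} \<subseteq> S"
    show "\<exists>S\<in>insert ?N (P ` V). K \<subseteq> S"
    proof (cases "K \<subseteq> \<Union>(P ` V)")
      case False
      then obtain k where k: "k \<in> K" "k \<notin> \<Union>(P ` V)" by blast
      have "v \<in> ?N" if v: "v \<in> K" for v
      proof -
        obtain S where "S \<in> insert ?N (P ` V)" "{k, v} \<subseteq> S" using K[rule_format, OF k(1) v] by blast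
        moreover have "S \<notin> P ` V" using k(2) \<open>{k, v} \<subseteq> S\<close> by blast
        ultimately show ?thesis by simp
      qed
      then show ?thesis by blast
    next
      case True
      have "\<exists>S\<in>P ` V. {u, v} \<subseteq> S" if "u \<in> K" "v \<in> K" for u v
      proof (cases "{u, v} \<subseteq> ?N")
        case True
        then have "{u, v} \<subseteq> P Si"
          using that \<open>K \<subseteq> \<Union>(P ` V)\<close> glue_Int[OF select.hyps] by blast
        then show ?thesis using select.hyps(3) by blast
      next
        case False
        then show ?thesis using K[rule_format, OF that] by auto
      qed
      then have "\<exists>S\<in>P ` V. K \<subseteq> S"
        using select.IH by (simp add: clique_helly_def)
      then show ?thesis by blast
    qed
  qed
qed

text \<open>An index that the new copy shares with a selected one also lies in \<open>P Si\<close>,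
  so an old path to \<open>Si\<close> extends by the new edge. Confining the relation to
  \<open>V\<close> lets old paths survive the change of \<open>P\<close> at
  \<open>Sj\<close>.\<close>

lemma running_intersection_P:
  "reform_state \<alpha> T P\<^sub>0 V P \<Longrightarrow> S \<in> V \<Longrightarrow> S' \<in> V \<Longrightarrow> x \<in> P S \<inter> P S' \<Longrightarrow>
     (\<lambda>U W. {U, W} \<in> edges T \<and> U \<in> V \<and> W \<in> V \<and> x \<in> P U \<inter> P W)\<^sup>*\<^sup>* S S'"
proof (induction arbitrary: S S' rule: reform_state.induct)
  case (start S1)
  then show ?case by simp
next
  case (select V P Si Sj)
  let ?P = "P(Sj := identify \<alpha> (P Si) (P Sj))"
  let ?R = "\<lambda>U W. {U, W} \<in> edges T \<and> U \<in> insert Sj V \<and> W \<in> insert Sj V \<and> x \<in> ?P U \<inter> ?P W"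
  have sym: "?R\<^sup>*\<^sup>* U W \<Longrightarrow> ?R\<^sup>*\<^sup>* W U" for U W
    by (rule sympD[OF symp_rtranclp]) (auto simp: symp_def insert_commute)
  have old: "?R\<^sup>*\<^sup>* U W" if "U \<in> V" "W \<in> V" "x \<in> P U \<inter> P W" for U W
    using select.IH[OF that]
    by (rule rtranclp_mono[THEN predicate2D, rotated]) (use select.hyps(4) in auto)
  have new: "?R\<^sup>*\<^sup>* U Sj" if "U \<in> V" "x \<in> P U" "x \<in> ?P Sj" for U
  proof -
    have "x \<in> P Si"
      using that glue_Int[OF select.hyps] by auto
    then have "?R\<^sup>*\<^sup>* U Si" "?R Si Sj"
      using that old select.hyps by auto
    then show ?thesis
      by (rule rtranclp.rtrancl_into_rtrancl)
  qed
  consider "S = Sj" "S' = Sj" | "S = Sj" "S' \<in> V" | "S \<in> V" "S' = Sj" | "S \<in> V" "S' \<in> V"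
    using select.prems by blast
  then show ?case
  proof cases
    case 1
    then show ?thesis by simp
  next
    case 2
    then have "x \<in> P S'" "x \<in> ?P Sj" using select.prems(3) select.hyps(4) by (auto split: if_splits)
    then show ?thesis using 2 sym[OF new] by simp
  next
    case 3
    then have "x \<in> P S" "x \<in> ?P Sj" using select.prems(3) select.hyps(4) by (auto split: if_splits)
    then show ?thesis using 3 new by simp
  next
    case 4
    then have "x \<in> P S \<inter> P S'" using select.prems(3) select.hyps(4) by (auto split: if_splits)
    then show ?thesis using 4 old by simp
  qed
qed

end

text \<open>A path around an image edge is pulled back step by step; injectivity of \<open>P\<close>
  makes the preimages of consecutive edges share the vertex where they meet.\<close>

lemma all_bridges_image:
  assumes "all_bridges T" "edges T \<subseteq> Pow (verts T)" "inj_on P (verts T)"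
  shows "all_bridges \<lparr>verts = P ` verts T, edges = image P ` edges T\<rparr>" (is "all_bridges ?T'")
  unfolding all_bridges_def
proof (intro allI impI notI)
  fix U W
  assume e: "{U, W} \<in> edges ?T'" and r: "(adj (delete_edge ?T' {U, W}))\<^sup>*\<^sup>* U W"
  from e obtain f where f: "f \<in> edges T" "{U, W} = P ` f" by auto
  have fV: "f \<subseteq> verts T" using f assms(2) by blast
  have "U \<in> P ` f" "W \<in> P ` f" using f(2) by auto
  then obtain u w where uw: "u \<in> f" "w \<in> f" "U = P u" "W = P w" by blast
  have "P ` f = P ` {u, w}"
    using f(2) uw by simp
  then have f_eq: "f = {u, w}"
    using inj_on_image_eq_iff[OF assms(3) fV, of "{u, w}"] uw fV by blast
  have pull_back: "\<exists>x\<in>verts T. X = P x \<and> (adj (delete_edge T f))\<^sup>*\<^sup>* u x"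
    if "(adj (delete_edge ?T' {U, W}))\<^sup>*\<^sup>* U X" for X
    using that
  proof (induction rule: rtranclp_induct)
    case base
    then show ?case using uw fV by blast
  next
    case (step X Y)
    then obtain x where x: "x \<in> verts T" "X = P x" "(adj (delete_edge T f))\<^sup>*\<^sup>* u x" by blast
    have "{X, Y} \<in> image P ` edges T" and ne: "{X, Y} \<noteq> {U, W}"
      using step.hyps(2) by (simp_all add: adj_def delete_edge_def)
    then obtain g where g: "g \<in> edges T" "{X, Y} = P ` g" "P ` g \<noteq> {U, W}"
      by (metis imageE)
    have gV: "g \<subseteq> verts T" using g assms(2) by blast
    have "Y \<in> P ` g" using g(2) by auto
    then obtain y where y: "y \<in> g" "Y = P y" by blast
    have "P ` g = P ` {x, y}"
      using g(2) x y by simp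
    then have "g = {x, y}"
      using inj_on_image_eq_iff[OF assms(3) gV, of "{x, y}"] x y gV by blast
    moreover have "g \<noteq> f" using g(3) f(2) by auto
    ultimately have "adj (delete_edge T f) x y"
      using g(1) by (auto simp: adj_def delete_edge_def)
    then show ?case
      using x y gV by (auto intro!: bexI[of _ y] intro: rtranclp.rtrancl_into_rtrancl)
  qed
  obtain x where "x \<in> verts T" "W = P x" "(adj (delete_edge T f))\<^sup>*\<^sup>* u x"
    using pull_back[OF r] by blast
  then have "(adj (delete_edge T f))\<^sup>*\<^sup>* u w"
    using uw fV assms(3) by (metis inj_onD subsetD)
  then show False
    using assms(1) f(1) f_eq by (auto simp: all_bridges_def)
qed

lemma reformulation_properties:
  assumes "finite \<S>" "\<forall>S\<in>\<S>. finite S" "reformulation \<S> \<S>' \<alpha> T'"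
  obtains P where "\<S>' = P ` \<S>" "inj_on P \<S>" "\<And>S. S \<in> \<S> \<Longrightarrow> bij_betw \<alpha> (P S) S"
    "\<And>S. S \<in> \<S> \<Longrightarrow> finite (P S)" "\<S>' \<noteq> {}"
    "verts T' = \<S>'" "edges T' \<subseteq> all_pairs \<S>'" "all_bridges T'" "running_intersection T'"
    "clique_helly \<S>'" "(\<Sum>S\<in>\<S>. card S) = card (\<Union>\<S>') + weight T'"
proof -
  obtain P\<^sub>0 \<alpha>\<^sub>0 T P where disj: "disjoint_family_on P\<^sub>0 \<S>"
    and bij0: "\<forall>S\<in>\<S>. bij_betw \<alpha>\<^sub>0 (P\<^sub>0 S) S"
    and mst: "max_spanning_tree \<S> T" and state: "reform_state \<alpha>\<^sub>0 T P\<^sub>0 \<S> P"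
    and S': "\<S>' = P ` \<S>" and \<alpha>: "\<alpha> = restrict \<alpha>\<^sub>0 (\<Union>\<S>')"
    and T': "T' = \<lparr>verts = \<S>', edges = (image P) ` edges T\<rparr>"
    using assms(3) unfolding reformulation_def by metis
  have tree: "is_tree T" and vT: "verts T = \<S>"
    using mst by (auto simp: max_spanning_tree_def spanning_tree_def intersection_graph_def)
  have eT: "edges T \<subseteq> all_pairs \<S>"
    using tree vT by (simp add: is_tree_def is_ugraph_def)
  then have eT_Pow: "edges T \<subseteq> Pow \<S>"
    by (auto simp: all_pairs_def)
  interpret gluing \<alpha>\<^sub>0 T P\<^sub>0
    by unfold_locales (use assms vT eT disj bij0 tree_all_bridges[OF tree] in auto)
  have bijP0: "bij_betw \<alpha>\<^sub>0 (P S) S" if "S \<in> \<S>" for S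
    using bij_P[OF state] that vT by simp
  \<comment> \<open>A copy determines its set as its image under
    \<open>\<alpha>\<^sub>0\<close>.\<close>
  have inj: "inj_on P \<S>"
    by (rule inj_onI) (metis bijP0 bij_betw_imp_surj_on)
  have bijP: "bij_betw \<alpha> (P S) S" if "S \<in> \<S>" for S
  proof -
    have "\<alpha> x = \<alpha>\<^sub>0 x" if "x \<in> P S" for x
      using that \<open>S \<in> \<S>\<close> by (auto simp: \<alpha> S')
    then show ?thesis using bijP0[OF that] bij_betw_cong by blast
  qed
  have T'_image: "T' = \<lparr>verts = P ` verts T, edges = image P ` edges T\<rparr>"
    using T' S' vT by simp
  have bridges': "all_bridges T'"
    unfolding T'_image by (rule all_bridges_image) (use bridges eT_Pow inj vT in auto)
  have eT': "edges T' \<subseteq> all_pairs \<S>'"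
  proof
    fix f assume "f \<in> edges T'"
    then obtain e where "e \<in> edges T" "f = P ` e" by (auto simp: T')
    moreover have "e \<in> all_pairs \<S>"
      using \<open>e \<in> edges T\<close> eT by (rule subsetD[rotated])
    then obtain u v where "e = {u, v}" "u \<in> \<S>" "v \<in> \<S>" "u \<noteq> v"
      by (auto simp: all_pairs_def)
    ultimately have "f = {P u, P v}" "P u \<in> \<S>'" "P v \<in> \<S>'" "P u \<noteq> P v"
      using inj by (auto simp: S' dest: inj_onD)
    then show "f \<in> all_pairs \<S>'"
      unfolding all_pairs_def by blast
  qed
  have ri: "running_intersection T'"
    unfolding running_intersection_def
  proof (intro ballI)
    fix S1 S2 x assume "S1 \<in> verts T'" "S2 \<in> verts T'" and x: "x \<in> S1 \<inter> S2"
    then obtain s1 s2 where s: "s1 \<in> \<S>" "S1 = P s1" "s2 \<in> \<S>" "S2 = P s2"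
      by (auto simp: T' S')
    let ?R = "\<lambda>U W. {U, W} \<in> edges T \<and> U \<in> \<S> \<and> W \<in> \<S> \<and> x \<in> P U \<inter> P W"
    let ?Q = "\<lambda>U W. adj T' U W \<and> x \<in> U \<inter> W"
    have lift: "?Q (P U) (P W)" if "?R U W" for U W
    proof -
      have "P ` {U, W} \<in> edges T'" using that by (simp add: T' del: image_insert)
      then show ?thesis using that by (simp add: adj_def)
    qed
    have "?R\<^sup>*\<^sup>* s1 s2"
      using running_intersection_P[OF state s(1,3)] x s by auto
    then have "?Q\<^sup>*\<^sup>* (P s1) (P s2)"
    proof (induction rule: rtranclp_induct)
      case (step U W)
      show ?case
        using step.IH lift[OF step.hyps(2)] by (rule rtranclp.rtrancl_into_rtrancl)
    qed simp
    then show "?Q\<^sup>*\<^sup>* S1 S2" using s by simp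
  qed
  have "weight T' = (\<Sum>e\<in>edges T. card (\<Inter>(P ` e)))"
  proof -
    \<comment> \<open>Distinct tree edges stay distinct, so no term of the weight is lost by mapping
      the edge set.\<close>
    have "inj_on (image P) (edges T)"
      by (rule inj_on_image, rule inj_on_subset[OF inj]) (use eT_Pow in blast)
    then show ?thesis by (simp add: weight_def T' mid_def sum.reindex)
  qed
  moreover have "{e \<in> edges T. e \<subseteq> \<S>} = edges T"
    using eT_Pow by blast
  ultimately have "(\<Sum>S\<in>\<S>. card S) = card (\<Union>\<S>') + weight T'"
    using card_indices[OF state] by (simp add: S')
  \<comment> \<open>The family is nonempty because the loop starts from one selected set.\<close>
  moreover have "\<S>' \<noteq> {}" "\<And>S. S \<in> \<S> \<Longrightarrow> finite (P S)"
    using select_verts[OF state] finite_P[OF state] vT by (auto simp: S')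
  ultimately show thesis
    using that[OF S' inj bijP] eT' bridges' ri clique_helly_P[OF state] by (auto simp: T' S')
qed

section \<open>The biclique cover\<close>

text \<open>The components are those of the subtree \<open>G\<close> without \<open>e\<close>, but
  reachability is stated in the whole tree without \<open>e\<close>. There the ends of
  \<open>e\<close> are separated, so they also lie in different components of \<open>G\<close>
  without \<open>e\<close>; as there are only two, these are \<open>V1\<close> and \<open>V2\<close>
  in some order.\<close>

lemma splits_endpoints:
  assumes "all_bridges T" "edges G \<subseteq> edges T" "edges G \<subseteq> all_pairs (verts G)" "splits G e V1 V2"
  obtains s1 s2 where "e = {s1, s2}" "s1 \<in> V1" "s2 \<in> V2"
    "\<forall>S\<in>V1. (adj (delete_edge T e))\<^sup>*\<^sup>* s1 S" "\<forall>S\<in>V2. (adj (delete_edge T e))\<^sup>*\<^sup>* s2 S"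
    "\<not> (adj (delete_edge T e))\<^sup>*\<^sup>* s1 s2"
proof -
  let ?G = "delete_edge G e" and ?T = "delete_edge T e"
  let ?C = "\<lambda>x. {v \<in> verts G. (adj ?G)\<^sup>*\<^sup>* x v}"
  have e: "e \<in> edges G" and comps: "component_sets ?G = {V1, V2}"
    using assms(4) by (auto simp: splits_def)
  have "e \<in> all_pairs (verts G)"
    using e assms(3) by blast
  then obtain a b where ab: "e = {a, b}" "a \<in> verts G" "b \<in> verts G"
    by (auto simp: all_pairs_def)
  have mono: "(adj ?T)\<^sup>*\<^sup>* x y" if "(adj ?G)\<^sup>*\<^sup>* x y" for x y
    by (rule adj_rtranclp_mono[OF that]) (use assms(2) in \<open>auto simp: delete_edge_def\<close>)
  have sep: "\<not> (adj ?T)\<^sup>*\<^sup>* a b"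
    using assms(1,2) e ab(1) by (auto simp: all_bridges_def)
  then have sep': "\<not> (adj ?T)\<^sup>*\<^sup>* b a"
    using adj_rtranclp_sym by metis
  have "?C a \<in> {V1, V2}" "?C b \<in> {V1, V2}"
    unfolding comps[symmetric] using ab by (auto simp: component_sets_def delete_edge_def)
  moreover have mem: "a \<in> ?C a" "b \<in> ?C b"
    using ab by simp_all
  moreover have "?C a \<noteq> ?C b"
  proof
    assume "?C a = ?C b"
    with mem have "(adj ?G)\<^sup>*\<^sup>* a b" by blast
    then show False using sep mono by blast
  qed
  ultimately consider "V1 = ?C a" "V2 = ?C b" | "V1 = ?C b" "V2 = ?C a"
    by auto
  then show thesis
  proof cases
    case 1
    then show thesis using that[of a b] ab sep mono by auto
  next
    case 2
    show thesis
    proof (rule that[of b a])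
      show "e = {b, a}" using ab(1) by auto
    qed (use 2 ab(2,3) sep' mono in auto)
  qed
qed

lemma splits_partition:
  assumes "splits G e V1 V2"
  shows "V1 \<union> V2 = verts G" "V1 \<inter> V2 = {}" "V1 \<noteq> {}" "V2 \<noteq> {}"
proof -
  have comps: "component_sets (delete_edge G e) = {V1, V2}" and "V1 \<noteq> V2"
    using assms by (auto simp: splits_def)
  then show "V1 \<inter> V2 = {}" "V1 \<noteq> {}" "V2 \<noteq> {}"
    using component_sets_disjoint[of V1 "delete_edge G e" V2]
      component_sets_nonempty[of _ "delete_edge G e"] by auto
  show "V1 \<union> V2 = verts G"
    using component_sets_cover[of "delete_edge G e"] comps by (simp add: delete_edge_def)
qed

text \<open>By running intersection, the tree vertices containing an index outside \<open>mid e\<close> all lie on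
  the same side of \<open>e\<close>, so no vertex of the whole tree contains indices from both parts.\<close>

lemma splits_biclique:
  assumes "all_bridges T" "running_intersection T"
    and "verts G \<subseteq> verts T" "edges G \<subseteq> edges T" "edges G \<subseteq> all_pairs (verts G)"
    and split: "splits G e V1 V2"
  shows "biclique_subgraph (conflict_graph (verts T)) (\<Union>V1 - mid e) (\<Union>V2 - mid e)"
proof -
  let ?R = "(adj (delete_edge T e))\<^sup>*\<^sup>*"
  obtain s1 s2 where s: "e = {s1, s2}" "\<forall>S\<in>V1. ?R s1 S" "\<forall>S\<in>V2. ?R s2 S" "\<not> ?R s1 s2"
    using splits_endpoints[OF assms(1,4,5) split] by metis
  have V: "V1 \<subseteq> verts T" "V2 \<subseteq> verts T"
    using splits_partition(1)[OF split] assms(3) by auto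
  have side: "?R S S'" if S: "S \<in> verts T" "S' \<in> verts T" and x: "x \<in> S" "x \<in> S'" "x \<notin> mid e" for S S' x
  proof -
    have path: "(\<lambda>U W. adj T U W \<and> x \<in> U \<inter> W)\<^sup>*\<^sup>* S S'"
      using assms(2) S x by (auto simp: running_intersection_def)
    have "adj (delete_edge T e) U W" if "adj T U W \<and> x \<in> U \<inter> W" for U W
    proof -
      have "{U, W} \<noteq> e" using that x(3) by (auto simp: mid_def)
      then show ?thesis using that by (simp add: adj_def delete_edge_def)
    qed
    then have "(\<lambda>U W. adj T U W \<and> x \<in> U \<inter> W) \<le> adj (delete_edge T e)"
      by auto
    then show ?thesis
      using path by (rule predicate2D[OF rtranclp_mono])
  qed
  \<comment> \<open>A common set \<open>S\<close> would bypass the bridge along \<open>s1\<close>,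
    \<open>S1\<close>, \<open>S\<close>, \<open>S2\<close>, \<open>s2\<close>. The case
    \<open>a = b\<close> yields disjointness of the two parts.\<close>
  have no_common: False
    if a: "a \<in> \<Union>V1 - mid e" and b: "b \<in> \<Union>V2 - mid e" and S: "S \<in> verts T" "a \<in> S" "b \<in> S" for a b S
  proof -
    obtain S1 where "S1 \<in> V1" "a \<in> S1" using a by blast
    obtain S2 where "S2 \<in> V2" "b \<in> S2" using b by blast
    have "?R S1 S" using side[of S1 S a] V \<open>S1 \<in> V1\<close> \<open>a \<in> S1\<close> S a by blast
    moreover have "?R S S2" using side[of S S2 b] V \<open>S2 \<in> V2\<close> \<open>b \<in> S2\<close> S b by blast
    moreover have "?R s1 S1" "?R S2 s2"
      using s(2,3) \<open>S1 \<in> V1\<close> \<open>S2 \<in> V2\<close> by (auto intro: adj_rtranclp_sym)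
    ultimately show False
      using s(4) by (meson rtranclp_trans)
  qed
  have "{a, b} \<in> edges (conflict_graph (verts T))"
    if a: "a \<in> \<Union>V1 - mid e" and b: "b \<in> \<Union>V2 - mid e" for a b
  proof -
    have "a \<noteq> b"
      using no_common[OF a b] a V by blast
    moreover have "a \<in> \<Union>(verts T)" "b \<in> \<Union>(verts T)"
      using a b V by auto
    moreover have "\<forall>S\<in>verts T. \<not> {a, b} \<subseteq> S"
      using no_common[OF a b] by blast
    ultimately show ?thesis
      unfolding conflict_graph_def by auto
  qed
  moreover have "(\<Union>V1 - mid e) \<inter> (\<Union>V2 - mid e) = {}"
    using no_common V by blast
  ultimately show ?thesis
    using V unfolding biclique_subgraph_def by (auto simp: conflict_graph_def)
qed

section \<open>Covering and counting in the separation recursion\<close>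

definition separated_by :: "('b set \<times> 'b set) list \<Rightarrow> 'b \<Rightarrow> 'b \<Rightarrow> bool" where
  "separated_by bcs u v \<longleftrightarrow> (\<exists>(A, B)\<in>set bcs. u \<in> A \<and> v \<in> B \<or> u \<in> B \<and> v \<in> A)"

lemma separated_by_Cons:
  "separated_by ((A, B) # bcs) u v \<longleftrightarrow> u \<in> A \<and> v \<in> B \<or> u \<in> B \<and> v \<in> A \<or> separated_by bcs u v"
  by (simp add: separated_by_def)

lemma set_interleave:
  fixes xs ys :: "'a list"
  shows
  "set (take 1 xs @ take 1 ys @ drop 1 xs @ drop 1 ys) = set xs \<union> set ys"
proof -
  have "set zs = set (take 1 zs) \<union> set (drop 1 zs)" for zs :: "'a list"
    by (metis append_take_drop_id set_append)
  from this[of xs] this[of ys] show ?thesis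
    unfolding set_append by blast
qed

text \<open>The bicliques are measured in the conflict graph of the whole tree \<open>T\<close>,
  whereas the covering claim is relative to the subtree \<open>G\<close>, so that it can pass to
  \<open>V1\<close> and \<open>V2\<close>. Each biclique uses up one edge: the count is
  \<open>1 + (card V1 - 1) + (card V2 - 1)\<close>.\<close>

lemma separation_properties:
  assumes "separation G bcs"
    and "all_bridges T" "running_intersection T" "finite (verts T)"
    and "verts G \<subseteq> verts T" "edges G \<subseteq> edges T" "edges G \<subseteq> all_pairs (verts G)"
  shows "(\<forall>(A, B)\<in>set bcs. biclique_subgraph (conflict_graph (verts T)) A B) \<and>
    (\<forall>u\<in>\<Union>(verts G). \<forall>v\<in>\<Union>(verts G).
       (\<forall>S\<in>verts G. \<not> {u, v} \<subseteq> S) \<longrightarrow> separated_by bcs u v) \<and>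
    (verts G \<noteq> {} \<longrightarrow> length bcs + 1 = card (verts G))"
  using assms(1,5,6,7)
proof (induction rule: separation.induct)
  case (trivial G)
  have fin: "finite (verts G)"
    using trivial.prems(1) assms(4) finite_subset by blast
  have "S = S'" if "S \<in> verts G" "S' \<in> verts G" for S S'
    using trivial.hyps fin that card_le_Suc0_iff_eq by auto
  then have "\<forall>u\<in>\<Union>(verts G). \<forall>v\<in>\<Union>(verts G). \<exists>S\<in>verts G. {u, v} \<subseteq> S"
    by blast
  then have "\<forall>u\<in>\<Union>(verts G). \<forall>v\<in>\<Union>(verts G).
      (\<forall>S\<in>verts G. \<not> {u, v} \<subseteq> S) \<longrightarrow> separated_by [] u v"
    by meson
  moreover have "card (verts G) = 1" if "verts G \<noteq> {}"
    using trivial.hyps card_gt_0_iff[of "verts G"] fin that by linarith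
  ultimately show ?case
    by (simp del: insert_subset)
next
  case (separate G e V1 V2 bc1 bc2)
  let ?A = "\<Union>V1 - mid e" and ?B = "\<Union>V2 - mid e"
  let ?bcs = "(?A, ?B) # take 1 bc1 @ take 1 bc2 @ drop 1 bc1 @ drop 1 bc2"
  note part = splits_partition[OF separate.hyps(2)]
  have set_bcs: "set ?bcs = insert (?A, ?B) (set bc1 \<union> set bc2)"
    using set_interleave[of bc1 bc2] by simp
  have fin: "finite V1" "finite V2"
    using part(1) separate.prems(1) assms(4) by (metis finite_Un finite_subset)+
  have induced: "verts (induced G V) \<subseteq> verts T" "edges (induced G V) \<subseteq> edges T"
    "edges (induced G V) \<subseteq> all_pairs (verts (induced G V))" if "V \<subseteq> verts G" for V
  proof -
    have "f \<in> all_pairs V" if f: "f \<in> edges G" "f \<subseteq> V" for f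
    proof -
      have "f \<in> all_pairs (verts G)" using f separate.prems(3) by blast
      then show ?thesis using f(2) unfolding all_pairs_def by blast
    qed
    then show "edges (induced G V) \<subseteq> all_pairs (verts (induced G V))"
      by (auto simp: induced_def)
  qed (use that separate.prems in \<open>auto simp: induced_def\<close>)
  have V: "V1 \<subseteq> verts G" "V2 \<subseteq> verts G"
    using part(1) by auto
  note IH1 = separate.IH(1)[OF induced[OF V(1)]]
  note IH2 = separate.IH(2)[OF induced[OF V(2)]]
  have verts_induced: "verts (induced G V) = V" for V
    by (simp add: induced_def)
  have sep1: "separated_by bc1 u v"
    if "u \<in> \<Union>V1" "v \<in> \<Union>V1" "\<forall>S\<in>verts G. \<not> {u, v} \<subseteq> S" for u v
    by (rule IH1[THEN conjunct2, THEN conjunct1, unfolded verts_induced, rule_format, OF that(1,2)])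
      (use that(3) V(1) in blast)
  have sep2: "separated_by bc2 u v"
    if "u \<in> \<Union>V2" "v \<in> \<Union>V2" "\<forall>S\<in>verts G. \<not> {u, v} \<subseteq> S" for u v
    by (rule IH2[THEN conjunct2, THEN conjunct1, unfolded verts_induced, rule_format, OF that(1,2)])
      (use that(3) V(2) in blast)
  obtain s1 s2 where "e = {s1, s2}" "s1 \<in> V1" "s2 \<in> V2"
    using splits_endpoints[OF assms(2) separate.prems(2,3) separate.hyps(2)] by metis
  then have mid_sub: "mid e \<subseteq> \<Union>V1" "mid e \<subseteq> \<Union>V2"
    by (auto simp: mid_def)
  have "separated_by ?bcs u v"
    if uv: "u \<in> \<Union>(verts G)" "v \<in> \<Union>(verts G)" and no: "\<forall>S\<in>verts G. \<not> {u, v} \<subseteq> S" for u v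
  proof -
    have "u \<in> \<Union>V1 \<or> u \<in> \<Union>V2" "v \<in> \<Union>V1 \<or> v \<in> \<Union>V2"
      using uv part(1) by auto
    \<comment> \<open>An index in \<open>mid e\<close> belongs to both sides, so a pair involving
      one lies together on the side of its partner and is left to the recursion.\<close>
    then consider "u \<in> \<Union>V1" "v \<in> \<Union>V1" | "u \<in> \<Union>V2" "v \<in> \<Union>V2"
      | "u \<in> ?A" "v \<in> ?B" | "u \<in> ?B" "v \<in> ?A"
      using mid_sub by blast
    then show ?thesis
    proof cases
      case 1
      then show ?thesis using sep1[OF _ _ no] unfolding separated_by_def set_bcs by blast
    next
      case 2
      then show ?thesis using sep2[OF _ _ no] unfolding separated_by_def set_bcs by blast
    qed (auto simp: separated_by_def)
  qed
  moreover have "\<forall>(A, B)\<in>set ?bcs. biclique_subgraph (conflict_graph (verts T)) A B"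
    using IH1 IH2 splits_biclique[OF assms(2,3) separate.prems separate.hyps(2)]
    unfolding set_bcs by auto
  moreover have "length ?bcs + 1 = card (verts G)"
  proof -
    have "length bc1 + 1 = card V1" "length bc2 + 1 = card V2"
      using IH1 IH2 part by (simp_all add: induced_def)
    moreover have "card (verts G) = card V1 + card V2"
      using card_Un_disjoint[OF fin part(2)] part(1) by simp
    ultimately show ?thesis by auto
  qed
  ultimately show ?case by blast
qed

section \<open>Merging\<close>

lemma merge_one_bicliques:
  assumes "\<forall>(A, B)\<in>set ((A, B) # ms). biclique_subgraph G A B"
  shows "\<forall>(A, B)\<in>set (merge_one G (A, B) ms). biclique_subgraph G A B"
  using assms by (induction ms) (auto split: if_splits)

text \<open>A merge only enlarges parts, so no separated pair is lost; exchanging the parts is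
  harmless because \<open>separated_by\<close> is symmetric in them.\<close>

lemma merge_one_separated:
  assumes "separated_by ((A, B) # ms) u v"
  shows "separated_by (merge_one G (A, B) ms) u v"
  using assms
proof (induction ms)
  case (Cons P ms)
  obtain A' B' where "P = (A', B')" by fastforce
  then show ?case
    using Cons by (auto simp: separated_by_Cons)
qed simp

lemma length_merge_one: "length (merge_one G (A, B) ms) \<le> Suc (length ms)"
  by (induction ms) auto

lemma merge_properties:
  assumes "\<forall>(A, B)\<in>set bcs \<union> set ms. biclique_subgraph G A B"
  shows "(\<forall>(A, B)\<in>set (fold (merge_one G) bcs ms). biclique_subgraph G A B) \<and>
    (\<forall>u v. separated_by (bcs @ ms) u v \<longrightarrow> separated_by (fold (merge_one G) bcs ms) u v) \<and>
    length (fold (merge_one G) bcs ms) \<le> length bcs + length ms"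
  using assms
proof (induction bcs arbitrary: ms)
  case Nil
  then show ?case by simp
next
  case (Cons P bcs)
  obtain A B where P: "P = (A, B)" by fastforce
  let ?ms = "merge_one G (A, B) ms"
  have "\<forall>(A, B)\<in>set ?ms. biclique_subgraph G A B"
    by (rule merge_one_bicliques) (use Cons.prems P in auto)
  then have *: "\<forall>(A, B)\<in>set bcs \<union> set ?ms. biclique_subgraph G A B"
    using Cons.prems by auto
  have "separated_by (bcs @ ?ms) u v" if "separated_by ((P # bcs) @ ms) u v" for u v
  proof (cases "separated_by bcs u v")
    case False
    then have "separated_by ((A, B) # ms) u v"
      using that P unfolding separated_by_def by auto
    then have "separated_by ?ms u v"
      by (rule merge_one_separated)
    then show ?thesis unfolding separated_by_def by auto
  qed (auto simp: separated_by_def)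
  then show ?case
    using Cons.IH[OF *] length_merge_one[of G A B ms] P by fastforce
qed

lemma biclique_cover_algorithm_properties:
  assumes "biclique_cover_algorithm \<S>' T' BC" "all_bridges T'" "running_intersection T'"
    and "finite \<S>'" "\<S>' \<noteq> {}" "verts T' = \<S>'" "edges T' \<subseteq> all_pairs \<S>'"
  shows "biclique_cover (conflict_graph \<S>') BC" "card BC + 1 \<le> card \<S>'"
proof -
  let ?G = "conflict_graph \<S>'"
  obtain bcs where sep: "separation T' bcs"
    and BC: "BC = (\<lambda>(A, B). {A, B}) ` set (merge_bicliques ?G bcs)"
    using assms(1) unfolding biclique_cover_algorithm_def by blast
  let ?ms = "merge_bicliques ?G bcs"
  have bcs: "\<forall>(A, B)\<in>set bcs. biclique_subgraph ?G A B"
    "\<And>u v. u \<in> \<Union>\<S>' \<Longrightarrow> v \<in> \<Union>\<S>' \<Longrightarrow> \<forall>S\<in>\<S>'. \<not> {u, v} \<subseteq> S \<Longrightarrow> separated_by bcs u v"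
    "length bcs + 1 = card \<S>'"
    using separation_properties[OF sep assms(2,3)] assms(4-7) by auto
  have ms: "\<forall>(A, B)\<in>set ?ms. biclique_subgraph ?G A B"
    "\<And>u v. separated_by bcs u v \<Longrightarrow> separated_by ?ms u v" "length ?ms \<le> length bcs"
    using merge_properties[of bcs "[]" ?G] bcs(1) by (auto simp: merge_bicliques_def)
  \<comment> \<open>Only an inequality: entries that agree as unordered pairs collapse in
    \<open>BC\<close>.\<close>
  have "card BC \<le> length ?ms"
    unfolding BC by (meson List.finite_set card_image_le card_length order_trans)
  then show "card BC + 1 \<le> card \<S>'"
    using ms(3) bcs(3) by linarith
  show "biclique_cover ?G BC"
    unfolding biclique_cover_def
  proof (intro conjI ballI)
    fix P assume "P \<in> BC"
    then obtain A B where "(A, B) \<in> set ?ms" "P = {A, B}"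
      unfolding BC by auto
    then show "\<exists>A B. P = {A, B} \<and> biclique_subgraph ?G A B"
      using ms(1) by blast
  next
    fix e assume "e \<in> edges ?G"
    then obtain u v where e: "e = {u, v}" "u \<in> \<Union>\<S>'" "v \<in> \<Union>\<S>'" "\<forall>S\<in>\<S>'. \<not> {u, v} \<subseteq> S"
      unfolding conflict_graph_def by auto
    obtain A B where AB: "(A, B) \<in> set ?ms" "u \<in> A \<and> v \<in> B \<or> u \<in> B \<and> v \<in> A"
      using ms(2)[OF bcs(2)[OF e(2-4)]] unfolding separated_by_def by blast
    have "{A, B} \<in> BC"
      using AB(1) unfolding BC by (auto intro: rev_image_eqI)
    then show "\<exists>A B. {A, B} \<in> BC \<and> (\<exists>a\<in>A. \<exists>b\<in>B. e = {a, b})"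
      using AB(2) e(1) by (metis insert_commute)
  qed
qed

section \<open>The linear programming relaxation\<close>

text \<open>The link equations determine \<lambda> from \<lambda>', so points of the relaxation are
  parametrised by \<lambda>' and \<open>z\<close> alone, and convex combinations need to be compared
  only there.\<close>

definition system_point ::
    "'a set \<Rightarrow> 'b set \<Rightarrow> ('b \<Rightarrow> 'a) \<Rightarrow> ('b \<Rightarrow> real) \<Rightarrow> (nat \<Rightarrow> real) \<Rightarrow> ('a, 'b) var \<Rightarrow> real" where
  "system_point J J' \<alpha> q z = (\<lambda>x. case x of
     Lam v \<Rightarrow> if v \<in> J then \<Sum>u\<in>{u \<in> J'. \<alpha> u = v}. q u else 0
   | Lam' u \<Rightarrow> q u | Z i \<Rightarrow> z i)"

lemma system_point_combine:
  "system_point J J' \<alpha> (\<lambda>u. (1 - c) * q u + c * q' u) (\<lambda>i. (1 - c) * z i + c * z' i) =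
     (1 - c) *\<^sub>R system_point J J' \<alpha> q z + c *\<^sub>R system_point J J' \<alpha> q' z'"
  by (rule ext) (auto simp: system_point_def scaleR_fun_def sum.distrib sum_distrib_left split: var.split)

locale disjoint_pairs =
  fixes J :: "'a set" and J' :: "'b set" and \<alpha> :: "'b \<Rightarrow> 'a" and t :: nat
    and A B :: "nat \<Rightarrow> 'b set"
  assumes finite_J: "finite J" and finite_J': "finite J'"
    and A_sub: "\<And>j. j \<in> {1..t} \<Longrightarrow> A j \<subseteq> J'" and B_sub: "\<And>j. j \<in> {1..t} \<Longrightarrow> B j \<subseteq> J'"
    and AB_disjoint: "\<And>j. j \<in> {1..t} \<Longrightarrow> A j \<inter> B j = {}"
begin

abbreviation "M \<equiv> biclique_system J J' \<alpha> t A B"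
abbreviation "point \<equiv> system_point J J' \<alpha>"

lemma relaxation_iff:
  "p \<in> lp_relaxation M \<longleftrightarrow>
    (\<forall>v. v \<notin> J \<longrightarrow> p (Lam v) = 0) \<and> (\<forall>i. i \<notin> {1..t} \<longrightarrow> p (Z i) = 0) \<and>
    (\<forall>v\<in>J. p (Lam v) = (\<Sum>u\<in>{u \<in> J'. \<alpha> u = v}. p (Lam' u))) \<and>
    (\<forall>j\<in>{1..t}. (\<Sum>u\<in>A j. p (Lam' u)) \<le> p (Z j)) \<and>
    (\<forall>j\<in>{1..t}. (\<Sum>u\<in>B j. p (Lam' u)) \<le> 1 - p (Z j)) \<and>
    (\<forall>j\<in>{1..t}. 0 \<le> p (Z j) \<and> p (Z j) \<le> 1) \<and>
    (\<lambda>u. p (Lam' u)) \<in> simplex_on J'"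
  by (rule lp_relaxation_biclique_system[OF finite_J finite_J' A_sub B_sub])

lemma finite_parts: "j \<in> {1..t} \<Longrightarrow> finite (A j)" "j \<in> {1..t} \<Longrightarrow> finite (B j)"
  by (auto intro: finite_subset[OF A_sub finite_J'] finite_subset[OF B_sub finite_J'])

lemma relaxation_point:
  assumes "p \<in> lp_relaxation M"
  shows "p = point (\<lambda>u. p (Lam' u)) (\<lambda>i. p (Z i))"
proof
  fix x show "p x = point (\<lambda>u. p (Lam' u)) (\<lambda>i. p (Z i)) x"
    using assms relaxation_iff[of p] by (cases x) (auto simp: system_point_def)
qed

text \<open>The bounds on each \<open>z j\<close> follow from the two inequalities, since both sums
  are nonnegative.\<close>

lemma point_in_relaxation:
  assumes "q \<in> simplex_on J'" "\<And>i. i \<notin> {1..t} \<Longrightarrow> z i = 0"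
    and "\<And>j. j \<in> {1..t} \<Longrightarrow> sum q (A j) \<le> z j" "\<And>j. j \<in> {1..t} \<Longrightarrow> sum q (B j) \<le> 1 - z j"
  shows "point q z \<in> lp_relaxation M"
proof -
  have "0 \<le> sum q (A j)" "0 \<le> sum q (B j)" if "j \<in> {1..t}" for j
    using that A_sub B_sub assms(1) by (auto intro!: sum_nonneg simp: simplex_on_def)
  then have "0 \<le> z j \<and> z j \<le> 1" if "j \<in> {1..t}" for j
    using assms(3,4)[OF that] that by force
  then show ?thesis
    unfolding relaxation_iff using assms by (simp add: system_point_def)
qed

lemma not_extreme:
  assumes "p \<in> lp_relaxation M" "0 < c" "c < 1"
    and "point q z \<in> lp_relaxation M" "point q' z' \<in> lp_relaxation M"
    and "point q z \<noteq> point q' z'"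
    and "\<And>u. p (Lam' u) = (1 - c) * q u + c * q' u" "\<And>i. p (Z i) = (1 - c) * z i + c * z' i"
  shows "\<not> p extreme_point_of lp_relaxation M"
proof -
  have "p = (1 - c) *\<^sub>R point q z + c *\<^sub>R point q' z'"
    using relaxation_point[OF assms(1)] assms(7,8) by (simp add: system_point_combine)
  then have "p \<in> open_segment (point q z) (point q' z')"
    unfolding in_segment using assms(2,3,6) by blast
  then show ?thesis
    using assms(4,5) by (auto simp: extreme_point_of_def)
qed

text \<open>Any index \<open>v\<close> with \<open>0 < \<lambda>'\<^sub>v < 1\<close> can be split off: \<open>p\<close> is a proper convex combination of a
  point with \<open>\<lambda>' = e\<^sub>v\<close> and one with the renormalised rest. When \<open>v\<close> lies in neither part \<open>j\<close>,
  its \<open>z\<^sub>j\<close> divides \<open>[0,1]\<close> as \<open>z\<^sub>j\<close> divides the interval between the two bounds on it.\<close>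

lemma extreme_unit_vector:
  assumes ext: "p extreme_point_of lp_relaxation M" and v: "v \<in> J'" "0 < p (Lam' v)"
  shows "p (Lam' v) = 1"
proof (rule ccontr)
  assume ne: "p (Lam' v) \<noteq> 1"
  have p: "p \<in> lp_relaxation M"
    using ext by (simp add: extreme_point_of_def)
  define q z c where "q u = p (Lam' u)" and "z i = p (Z i)" and "c = p (Lam' v)" for u i
  have q: "q \<in> simplex_on J'" and z0: "\<And>i. i \<notin> {1..t} \<Longrightarrow> z i = 0"
    and zA: "\<And>j. j \<in> {1..t} \<Longrightarrow> sum q (A j) \<le> z j"
    and zB: "\<And>j. j \<in> {1..t} \<Longrightarrow> sum q (B j) \<le> 1 - z j"
    using p relaxation_iff[of p] unfolding q_def z_def by auto
  have q_nonneg: "0 \<le> q u" for u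
    using q by (cases "u \<in> J'") (auto simp: simplex_on_def)
  have q_out: "u \<notin> J' \<Longrightarrow> q u = 0" for u
    using q by (simp add: simplex_on_def)
  have q_sum: "sum q J' = 1"
    using q by (simp add: simplex_on_def)
  have "c \<le> sum q J'"
    using member_le_sum[of v J' q] v(1) finite_J' q_nonneg by (simp add: c_def q_def)
  then have c: "0 < c" "c < 1"
    using v(2) ne q_sum by (auto simp: c_def)
  define a b where "a j = sum q (A j)" and "b j = sum q (B j)" for j
  define qv :: "'b \<Rightarrow> real" where "qv u = (if u = v then 1 else 0)" for u
  \<comment> \<open>The solution of \<open>q = (1 - c) * qr + c * qv\<close>, with entry 0 at
    \<open>v\<close>; \<open>zr\<close> arises from \<open>z\<close> and \<open>zv\<close> in the
    same way.\<close>
  define qr where "qr u = (q u - c * qv u) / (1 - c)" for u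
  define zv where "zv j = (if j \<notin> {1..t} then 0 else if v \<in> A j then 1 else if v \<in> B j then 0
    else (z j - a j) / (1 - a j - b j))" for j
  define zr where "zr j = (z j - c * zv j) / (1 - c)" for j
  have qv_sum: "sum qv X = (if v \<in> X then 1 else 0)" if "finite X" for X
    unfolding qv_def using that by (simp add: sum.delta)
  have qr_sum: "sum qr X = (sum q X - c * (if v \<in> X then 1 else 0)) / (1 - c)" if "finite X" for X
    unfolding qr_def sum_divide_distrib[symmetric] sum_subtractf sum_distrib_left[symmetric]
      qv_sum[OF that] ..
  \<comment> \<open>The indices outside both parts carry at least the mass \<open>c\<close> of
    \<open>v\<close>. So the interval from \<open>a j\<close> to \<open>1 - b j\<close> available to
    \<open>z j\<close> has length at least \<open>c\<close>, and dividing by that length is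
    safe.\<close>
  have rest: "c \<le> 1 - a j - b j" if "j \<in> {1..t}" "v \<notin> A j" "v \<notin> B j" for j
  proof -
    have "a j + b j + c = sum q (insert v (A j \<union> B j))"
      using that finite_parts[OF that(1)] AB_disjoint[OF that(1)]
      by (simp add: sum.union_disjoint a_def b_def c_def q_def)
    also have "\<dots> \<le> sum q J'"
      using v(1) A_sub[OF that(1)] B_sub[OF that(1)] finite_J' q_nonneg
      by (intro sum_mono2) auto
    finally show ?thesis using q_sum by linarith
  qed
  have zv_bounds: "0 \<le> zv j" "zv j \<le> 1" if "j \<in> {1..t}" for j
    using rest[OF that] zA[OF that] zB[OF that] c(1) unfolding zv_def a_def[symmetric] b_def[symmetric]
    by (auto simp: divide_le_eq le_divide_eq)
  have unit: "point qv zv \<in> lp_relaxation M"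
  proof (rule point_in_relaxation)
    show "qv \<in> simplex_on J'"
      using v(1) qv_sum[OF finite_J'] by (auto simp: simplex_on_def qv_def)
    fix j assume j: "j \<in> {1..t}"
    show "sum qv (A j) \<le> zv j"
      using j zv_bounds(1)[OF j] unfolding qv_sum[OF finite_parts(1)[OF j]]
      by (cases "v \<in> A j") (simp add: zv_def, simp)
    show "sum qv (B j) \<le> 1 - zv j"
      using j zv_bounds(2)[OF j] AB_disjoint[OF j] unfolding qv_sum[OF finite_parts(2)[OF j]]
      by (cases "v \<in> B j") ((auto simp: zv_def)[1], simp)
  qed (simp add: zv_def)
  have remainder: "point qr zr \<in> lp_relaxation M"
  proof (rule point_in_relaxation)
    show "qr \<in> simplex_on J'"
      using c q_nonneg q_out v(1) qr_sum[OF finite_J'] q_sum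
      by (auto simp: simplex_on_def qr_def qv_def c_def q_def)
    fix j assume j: "j \<in> {1..t}"
    consider "v \<in> A j" "v \<notin> B j" | "v \<in> B j" "v \<notin> A j" | "v \<notin> A j" "v \<notin> B j"
      using AB_disjoint[OF j] by blast
    \<comment> \<open>The two constraints on the remainder, multiplied by
      \<open>1 - c\<close>.\<close>
    then have "a j - c * (if v \<in> A j then 1 else 0) \<le> z j - c * zv j \<and>
      b j - c * (if v \<in> B j then 1 else 0) \<le> 1 - c - (z j - c * zv j)"
    proof cases
      case 3
      define d where "d = 1 - a j - b j"
      have d: "0 < d" "c \<le> d"
        using rest[OF j 3] c(1) by (auto simp: d_def)
      have zv: "zv j = (z j - a j) / d" "1 - zv j = (1 - b j - z j) / d"
        using 3 j d(1) by (auto simp: zv_def d_def field_simps)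
      \<comment> \<open>The unit point takes the fraction \<open>c / d \<le> 1\<close> of the
        distance from \<open>z j\<close> to each of its bounds, which leaves both distances
        nonnegative.\<close>
      have shrink: "c * (y / d) \<le> y" if "0 \<le> y" for y
        using mult_right_mono[OF d(2) that] d(1) by (simp add: field_simps)
      have "c * zv j \<le> z j - a j"
        unfolding zv(1) using zA[OF j] by (intro shrink) (simp add: a_def)
      moreover have "c * (1 - zv j) \<le> 1 - b j - z j"
        unfolding zv(2) using zB[OF j] by (intro shrink) (simp add: b_def)
      ultimately show ?thesis
        using 3 by (simp add: algebra_simps)
    qed (use j zA[OF j] zB[OF j] in \<open>auto simp: zv_def a_def b_def\<close>)
    then have bounds: "a j - c * (if v \<in> A j then 1 else 0) \<le> z j - c * zv j"
      "b j - c * (if v \<in> B j then 1 else 0) \<le> 1 - c - (z j - c * zv j)" by auto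
    show "sum qr (A j) \<le> zr j"
      unfolding qr_sum[OF finite_parts(1)[OF j]] zr_def a_def[symmetric]
      using bounds(1) c(2) by (intro divide_right_mono) auto
    have "1 - zr j = (1 - c - (z j - c * zv j)) / (1 - c)"
      using c(2) by (simp add: zr_def diff_divide_distrib)
    then show "sum qr (B j) \<le> 1 - zr j"
      unfolding qr_sum[OF finite_parts(2)[OF j]] b_def[symmetric]
      using bounds(2) c(2) by (simp only:) (intro divide_right_mono; simp)
  qed (simp add: zr_def zv_def z0)
  have "point qr zr (Lam' v) \<noteq> point qv zv (Lam' v)"
    by (simp add: system_point_def qr_def qv_def c_def q_def)
  then have "point qr zr \<noteq> point qv zv"
    by metis
  moreover have "p (Lam' u) = (1 - c) * qr u + c * qv u" "p (Z i) = (1 - c) * zr i + c * zv i" for u i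
    using c(2) by (simp_all add: qr_def zr_def q_def z_def)
  ultimately have "\<not> p extreme_point_of lp_relaxation M"
    by (intro not_extreme[OF p c remainder unit])
  then show False
    using ext by contradiction
qed

text \<open>A fractional \<open>z j\<close> keeps both of its sums below 1, hence at 0, because
  positive entries of \<lambda>' equal 1. Then \<open>z j\<close> may be moved to either end of the
  unit interval, and \<open>p\<close> lies strictly between the two results.\<close>

lemma extreme_point_integral:
  assumes ext: "p extreme_point_of lp_relaxation M"
  shows "integral_point M p"
proof -
  have p: "p \<in> lp_relaxation M"
    using ext by (simp add: extreme_point_of_def)
  define q z where "q u = p (Lam' u)" and "z i = p (Z i)" for u i
  have q: "q \<in> simplex_on J'" and z0: "\<And>i. i \<notin> {1..t} \<Longrightarrow> z i = 0"
    and zA: "\<And>j. j \<in> {1..t} \<Longrightarrow> sum q (A j) \<le> z j"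
    and zB: "\<And>j. j \<in> {1..t} \<Longrightarrow> sum q (B j) \<le> 1 - z j"
    and z01: "\<And>j. j \<in> {1..t} \<Longrightarrow> 0 \<le> z j \<and> z j \<le> 1"
    using p relaxation_iff[of p] unfolding q_def z_def by auto
  have q_nonneg: "0 \<le> q u" for u
    using q by (cases "u \<in> J'") (auto simp: simplex_on_def)
  have q_sum: "sum q J' = 1"
    using q by (simp add: simplex_on_def)
  have zero_sum: "sum q X = 0" if "X \<subseteq> J'" "sum q X < 1" for X
  proof (rule sum.neutral, rule ballI)
    fix u assume u: "u \<in> X"
    have "q u \<le> sum q X"
      using u q_nonneg finite_subset[OF that(1) finite_J'] by (intro member_le_sum) auto
    then have "q u \<noteq> 1" using that(2) by simp
    then show "q u = 0"
      using extreme_unit_vector[OF ext, of u] q_nonneg[of u] u that(1) unfolding q_def by force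
  qed
  have "z j \<in> {0, 1}" if j: "j \<in> {1..t}" for j
  proof (rule ccontr)
    assume "z j \<notin> {0, 1}"
    then have zj: "0 < z j" "z j < 1"
      using z01[OF j] by auto
    have AB0: "sum q (A j) = 0" "sum q (B j) = 0"
      using zero_sum A_sub[OF j] B_sub[OF j] zA[OF j] zB[OF j] zj by force+
    have flip: "point q (z(j := 0)) \<in> lp_relaxation M" "point q (z(j := 1)) \<in> lp_relaxation M"
      by (rule point_in_relaxation; use q z0 zA zB AB0 j in auto)+
    have "point q (z(j := 0)) (Z j) \<noteq> point q (z(j := 1)) (Z j)"
      by (simp add: system_point_def)
    then have "point q (z(j := 0)) \<noteq> point q (z(j := 1))"
      by metis
    \<comment> \<open>The convex coefficient is \<open>z j\<close> itself.\<close>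
    then have "\<not> p extreme_point_of lp_relaxation M"
      by (rule not_extreme[OF p zj flip]) (simp_all add: q_def z_def algebra_simps)
    then show False
      using ext by contradiction
  qed
  then show ?thesis
    unfolding integral_point_def z_def by (simp add: biclique_system_def)
qed

lemma integral_point_M: "integral_point M p \<longleftrightarrow> (\<forall>j\<in>{1..t}. p (Z j) \<in> {0, 1})"
  by (auto simp: integral_point_def biclique_system_def)

end

text \<open>A binary \<open>z j\<close> shuts one part of each biclique, so the cover makes the
  support of \<lambda>' pairwise compatible; \<open>helly\<close> puts it into one copy
  \<open>P S\<close>, which \<alpha> maps into \<open>S\<close>. Conversely, a point supported on
  \<open>S\<close> is lifted along the bijection from \<open>P S\<close>.\<close>

lemma biclique_system_formulation:
  fixes \<S> :: "'a set set" and P :: "'a set \<Rightarrow> 'b set" and \<alpha> :: "'b \<Rightarrow> 'a"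
  assumes "disjoint_pairs (\<Union>\<S>) (\<Union>(P ` \<S>)) t A B"
    and bij: "\<And>S. S \<in> \<S> \<Longrightarrow> bij_betw \<alpha> (P S) S"
    and helly: "clique_helly (P ` \<S>)"
    and biclique: "\<And>j. j \<in> {1..t} \<Longrightarrow> biclique_subgraph (conflict_graph (P ` \<S>)) (A j) (B j)"
    and cover: "\<And>u v. {u, v} \<in> edges (conflict_graph (P ` \<S>)) \<Longrightarrow>
      \<exists>j\<in>{1..t}. u \<in> A j \<and> v \<in> B j \<or> u \<in> B j \<and> v \<in> A j"
  shows "formulation (biclique_system (\<Union>\<S>) (\<Union>(P ` \<S>)) \<alpha> t A B) \<S>"
proof -
  let ?J = "\<Union>\<S>" and ?J' = "\<Union>(P ` \<S>)"
  interpret disjoint_pairs ?J ?J' \<alpha> t A B by fact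
  have \<alpha>_J: "\<alpha> u \<in> S" if "u \<in> P S" "S \<in> \<S>" for u S
    using bij[OF that(2)] that(1) by (auto simp: bij_betw_def)
  have sub: "(\<lambda>v. p (Lam v)) \<in> CDC \<S>" if "p \<in> feasible_set M" for p
  proof -
    define q where "q u = p (Lam' u)" for u
    have p: "p \<in> lp_relaxation M" and int: "\<And>j. j \<in> {1..t} \<Longrightarrow> p (Z j) \<in> {0, 1}"
      using that by (auto simp: feasible_set_def integral_point_M)
    have q: "q \<in> simplex_on ?J'"
      and Lam: "\<And>v. v \<in> ?J \<Longrightarrow> p (Lam v) = (\<Sum>u\<in>{u \<in> ?J'. \<alpha> u = v}. q u)"
        "\<And>v. v \<notin> ?J \<Longrightarrow> p (Lam v) = 0"
      and zA: "\<And>j. j \<in> {1..t} \<Longrightarrow> sum q (A j) \<le> p (Z j)"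
      and zB: "\<And>j. j \<in> {1..t} \<Longrightarrow> sum q (B j) \<le> 1 - p (Z j)"
      using p unfolding relaxation_iff q_def by auto
    have q_nonneg: "0 \<le> q u" for u
      using q by (cases "u \<in> ?J'") (auto simp: simplex_on_def)
    have supp: "u \<in> ?J'" if "q u \<noteq> 0" for u
      using q that unfolding simplex_on_def by blast
    have one_side: "q u = 0 \<or> q v = 0" if "j \<in> {1..t}" "u \<in> A j" "v \<in> B j" for j u v
    proof -
      have "q u \<le> sum q (A j)" "q v \<le> sum q (B j)"
        using that finite_parts q_nonneg by (auto intro: member_le_sum)
      then have "q u \<le> 0 \<or> q v \<le> 0"
        using zA[OF that(1)] zB[OF that(1)] int[OF that(1)] by auto
      then show ?thesis using q_nonneg by (meson order_antisym)
    qed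
    have "\<exists>S\<in>P ` \<S>. {u, v} \<subseteq> S" if "q u \<noteq> 0" "q v \<noteq> 0" for u v
    proof (rule ccontr)
      assume no: "\<not> (\<exists>S\<in>P ` \<S>. {u, v} \<subseteq> S)"
      then have "u \<noteq> v" using supp[OF that(1)] by auto
      then have "{u, v} \<in> edges (conflict_graph (P ` \<S>))"
        using no supp[OF that(1)] supp[OF that(2)] unfolding conflict_graph_def by auto
      then show False
        using cover one_side that by blast
    qed
    then obtain S where S: "S \<in> \<S>" "{u. q u \<noteq> 0} \<subseteq> P S"
      using helly unfolding clique_helly_def by (auto elim!: allE[of _ "{u. q u \<noteq> 0}"])
    have "(\<Sum>v\<in>?J. p (Lam v)) = (\<Sum>v\<in>?J. \<Sum>u\<in>{u \<in> ?J'. \<alpha> u = v}. q u)"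
      by (simp add: Lam)
    also have "\<dots> = sum q ?J'"
      by (rule sum.group[OF finite_J' finite_J]) (auto dest: \<alpha>_J)
    also have "\<dots> = 1"
      using q by (simp add: simplex_on_def)
    finally have Lam_sum: "(\<Sum>v\<in>?J. p (Lam v)) = 1" .
    have "0 \<le> p (Lam v)" if "v \<in> ?J" for v
      unfolding Lam(1)[OF that] by (intro sum_nonneg q_nonneg)
    then have "(\<lambda>v. p (Lam v)) \<in> simplex_on ?J"
      using Lam(2) Lam_sum unfolding simplex_on_def by blast
    moreover have "p (Lam v) = 0" if "v \<in> ?J - S" for v
    proof -
      have "q u = 0" if "\<alpha> u = v" for u
        using S \<alpha>_J[of u S] that \<open>v \<in> ?J - S\<close> by auto
      then show ?thesis using Lam(1)[of v] that by simp
    qed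
    ultimately show ?thesis
      using S(1) by (auto simp: CDC_def face_on_def)
  qed
  have sup: "l \<in> (\<lambda>p v. p (Lam v)) ` feasible_set M" if l_CDC: "l \<in> CDC \<S>" for l
  proof -
    obtain S where S: "S \<in> \<S>" and l_mem: "l \<in> face_on ?J S"
      using l_CDC by (auto simp: CDC_def)
    then have l: "l \<in> simplex_on ?J" "\<And>v. v \<notin> S \<Longrightarrow> l v = 0"
      unfolding face_on_def simplex_on_def by blast+
    define q where "q u = (if u \<in> P S then l (\<alpha> u) else 0)" for u
    \<comment> \<open>Opens part \<open>A j\<close> exactly when the chosen copy meets it;
      \<open>B j\<close> then misses the copy, because a conflict edge cannot lie inside
      \<open>P S\<close>.\<close>
    define z :: "nat \<Rightarrow> real" where "z j = (if j \<in> {1..t} \<and> A j \<inter> P S \<noteq> {} then 1 else 0)" for j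
    have l_nonneg: "0 \<le> l v" for v
      using l(1) by (cases "v \<in> ?J") (auto simp: simplex_on_def)
    have PS: "P S \<subseteq> ?J'" using S by blast
    have "sum q ?J' = sum q (P S)"
      using PS by (intro sum.mono_neutral_right finite_J') (auto simp: q_def)
    also have "\<dots> = (\<Sum>u\<in>P S. l (\<alpha> u))"
      by (simp add: q_def)
    also have "\<dots> = sum l S"
      by (rule sum.reindex_bij_betw[OF bij[OF S]])
    also have "\<dots> = sum l ?J"
      using S l(2) by (intro sum.mono_neutral_left finite_J) auto
    also have "\<dots> = 1"
      using l(1) by (simp add: simplex_on_def)
    finally have q: "q \<in> simplex_on ?J'"
      using l_nonneg PS by (auto simp: simplex_on_def q_def)
    have q_le: "sum q X \<le> 1" if "X \<subseteq> ?J'" for X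
    proof -
      have "sum q X \<le> sum q ?J'"
        using that finite_J' l_nonneg by (intro sum_mono2) (auto simp: q_def)
      then show ?thesis using q by (simp add: simplex_on_def)
    qed
    have q_0: "sum q X = 0" if "X \<inter> P S = {}" for X
      using that by (intro sum.neutral) (auto simp: q_def)
    have one_side: "A j \<inter> P S = {} \<or> B j \<inter> P S = {}" if "j \<in> {1..t}" for j
    proof (rule ccontr)
      assume "\<not> ?thesis"
      then obtain a b where ab: "a \<in> A j" "b \<in> B j" "{a, b} \<subseteq> P S" by auto
      then have "{a, b} \<in> edges (conflict_graph (P ` \<S>))"
        using biclique[OF that] by (auto simp: biclique_subgraph_def)
      then show False
        using ab(3) S unfolding conflict_graph_def by auto
    qed
    have "point q z \<in> lp_relaxation M"
    proof (rule point_in_relaxation[OF q])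
      fix j assume j: "j \<in> {1..t}"
      show "sum q (A j) \<le> z j"
        using q_0[of "A j"] q_le[OF A_sub[OF j]] j by (cases "A j \<inter> P S = {}") (simp_all add: z_def)
      show "sum q (B j) \<le> 1 - z j"
        using q_0[of "B j"] q_le[OF B_sub[OF j]] one_side[OF j] j
        by (cases "A j \<inter> P S = {}") (simp_all add: z_def)
    qed (auto simp: z_def)
    moreover have "integral_point M (point q z)"
      unfolding integral_point_M by (simp add: system_point_def z_def)
    ultimately have feasible: "point q z \<in> feasible_set M"
      by (simp add: feasible_set_def)
    have "l = (\<lambda>v. point q z (Lam v))"
    proof
      fix v
      have "(\<Sum>u\<in>{u \<in> ?J'. \<alpha> u = v}. q u) = l v" if "v \<in> ?J"
      proof (cases "v \<in> S")
        case True
        then obtain u where u: "u \<in> P S" "\<alpha> u = v"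
          using bij_betw_imp_surj_on[OF bij[OF S]] by (metis imageE)
        \<comment> \<open>Of all preimages of \<open>v\<close>, only the one in \<open>P S\<close>
          can carry weight, and \<alpha> is injective there.\<close>
        have "(\<Sum>u\<in>{u \<in> ?J'. \<alpha> u = v}. q u) = sum q {u}"
        proof (rule sum.mono_neutral_right)
          show "finite {u \<in> ?J'. \<alpha> u = v}"
            using finite_J' by (rule rev_finite_subset) blast
        qed (use u bij[OF S] PS in \<open>auto simp: q_def bij_betw_def dest: inj_onD\<close>)
        then show ?thesis using u by (simp add: q_def)
      next
        case False
        then have "(\<Sum>u\<in>{u \<in> ?J'. \<alpha> u = v}. q u) = 0"
          using \<alpha>_J S by (intro sum.neutral) (auto simp: q_def)
        then show ?thesis using l(2) False by simp
      qed
      moreover have "v \<notin> ?J \<Longrightarrow> l v = 0"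
        using l(2) S by blast
      ultimately show "l v = point q z (Lam v)"
        by (simp add: system_point_def)
    qed
    then show ?thesis
      using feasible by (rule image_eqI)
  qed
  show ?thesis
    unfolding formulation_def using sub sup by blast
qed

text \<open>The constraints form a set, so coincidences have to be excluded, even for empty parts.
  The coefficients of the \<open>Z\<close> variables tell different \<open>j\<close> apart, and the
  right-hand sides 0 and 1 distinguish the two kinds.\<close>

lemma card_inequalities:
  "card (inequalities (project_out_Lam (biclique_system J J' \<alpha> t A B))) = 2 * t"
proof -
  have inj: "inj_on (\<lambda>j. left_ineq (A j) j :: (('a, 'b) var \<Rightarrow> real) \<times> real) {1..t}"
    "inj_on (\<lambda>j. right_ineq (B j) j :: (('a, 'b) var \<Rightarrow> real) \<times> real) {1..t}"
    by (rule inj_onI, drule arg_cong[of _ _ fst], drule fun_cong[of _ _ "Z _"],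
        force simp: left_ineq_def right_ineq_def split: if_splits)+
  let ?L = "(\<lambda>j. left_ineq (A j) j :: (('a, 'b) var \<Rightarrow> real) \<times> real) ` {1..t}"
  let ?R = "(\<lambda>j. right_ineq (B j) j :: (('a, 'b) var \<Rightarrow> real) \<times> real) ` {1..t}"
  have "?L \<inter> ?R = {}"
    by (auto simp: left_ineq_def right_ineq_def)
  then have "card (?L \<union> ?R) = card ?L + card ?R"
    by (intro card_Un_disjoint) auto
  also have "\<dots> = 2 * t"
    unfolding card_image[OF inj(1)] card_image[OF inj(2)] by simp
  finally show ?thesis
    by (simp add: project_out_Lam_def biclique_system_def)
qed

theorem mainTheorem9:
  fixes \<S> :: "'a set set" and \<S>' :: "'b set set" and \<alpha> :: "'b \<Rightarrow> 'a"
    and T' :: "'b set ugraph" and BC :: "'b set set set"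
    and t :: nat and A' B' :: "nat \<Rightarrow> 'b set"
  assumes "finite \<S>" and "\<forall>S\<in>\<S>. finite S"
    and "reformulation \<S> \<S>' \<alpha> T'"
    and "biclique_cover_algorithm \<S>' T' BC"
    and "bij_betw (\<lambda>j. {A' j, B' j}) {1..t} BC"
  shows "biclique_cover (conflict_graph \<S>') BC \<and>
    (let J = \<Union>\<S>; J' = \<Union>\<S>';
         M = biclique_system J J' \<alpha> t A' B';
         N = project_out_Lam M
     in ideal_formulation M \<S> \<and>
        int (card (continuous_vars N)) - int (card J) = int (card J') - int (card J) \<and>
        int (card J') - int (card J) = (\<Sum>S\<in>\<S>. int (card S)) - int (weight T') - int (card J) \<and>
        card (binary_vars N) = t \<and>
        int t \<le> int (card \<S>') - 1 \<and> int (card \<S>') - 1 = int (card \<S>) - 1 \<and>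
        card (inequalities N) = 2 * t)"
proof -
  obtain P where S': "\<S>' = P ` \<S>" and inj: "inj_on P \<S>"
    and bij: "\<And>S. S \<in> \<S> \<Longrightarrow> bij_betw \<alpha> (P S) S" and finP: "\<And>S. S \<in> \<S> \<Longrightarrow> finite (P S)"
    and ne: "\<S>' \<noteq> {}" and vT': "verts T' = \<S>'" and eT': "edges T' \<subseteq> all_pairs \<S>'"
    and br: "all_bridges T'" and ri: "running_intersection T'" and helly: "clique_helly \<S>'"
    and count: "(\<Sum>S\<in>\<S>. card S) = card (\<Union>\<S>') + weight T'"
    using reformulation_properties[OF assms(1-3)] by metis
  have finS': "finite \<S>'" using S' assms(1) by simp
  note BC = biclique_cover_algorithm_properties[OF assms(4) br ri finS' ne vT' eT']
  let ?J = "\<Union>\<S>" and ?J' = "\<Union>\<S>'"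
  let ?M = "biclique_system ?J ?J' \<alpha> t A' B'"
  let ?N = "project_out_Lam ?M"
  have BC_eq: "BC = (\<lambda>j. {A' j, B' j}) ` {1..t}"
    using assms(5) by (simp add: bij_betw_def)
  \<comment> \<open>\<open>BC\<close> holds unordered pairs, so the enumeration may name the parts
    in either order.\<close>
  have sym: "biclique_subgraph (conflict_graph \<S>') B A"
    if "biclique_subgraph (conflict_graph \<S>') A B" for A B
    using that unfolding biclique_subgraph_def by (metis Int_commute insert_commute)
  have biclique: "biclique_subgraph (conflict_graph \<S>') (A' j) (B' j)" if "j \<in> {1..t}" for j
  proof -
    have "{A' j, B' j} \<in> BC" using that by (simp add: BC_eq)
    then obtain A B where "{A' j, B' j} = {A, B}" "biclique_subgraph (conflict_graph \<S>') A B"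
      using BC(1) unfolding biclique_cover_def by meson
    then show ?thesis using sym by (auto simp: doubleton_eq_iff)
  qed
  have cover: "\<exists>j\<in>{1..t}. u \<in> A' j \<and> v \<in> B' j \<or> u \<in> B' j \<and> v \<in> A' j"
    if uv: "{u, v} \<in> edges (conflict_graph \<S>')" for u v
  proof -
    obtain A B a b where AB: "{A, B} \<in> BC" "a \<in> A" "b \<in> B" "{u, v} = {a, b}"
      using BC(1) uv unfolding biclique_cover_def by meson
    then obtain j where "j \<in> {1..t}" "{A, B} = {A' j, B' j}"
      unfolding BC_eq by blast
    then show ?thesis
      using AB(2-4) by (auto simp: doubleton_eq_iff)
  qed
  have pairs: "disjoint_pairs ?J ?J' t A' B'"
  proof
    show "finite ?J" "finite ?J'"
      using assms(1,2) finP by (auto simp: S')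
    fix j assume "j \<in> {1..t}"
    then show "A' j \<subseteq> ?J'" "B' j \<subseteq> ?J'" "A' j \<inter> B' j = {}"
      using biclique[of j] by (auto simp: biclique_subgraph_def conflict_graph_def)
  qed
  have "formulation ?M \<S>"
    using biclique_system_formulation[of \<S> P t A' B' \<alpha>] pairs bij helly biclique cover
    unfolding S' by blast
  then have "ideal_formulation ?M \<S>"
    using disjoint_pairs.extreme_point_integral[OF pairs] by (auto simp: ideal_formulation_def)
  moreover have "card (continuous_vars ?N) = card ?J'"
  proof -
    have "continuous_vars ?N = Lam' ` ?J'"
      by (auto simp: continuous_vars_def project_out_Lam_def biclique_system_def)
    then show ?thesis by (simp add: card_image inj_on_def)
  qed
  moreover have "card (binary_vars ?N) = t"
    by (simp add: project_out_Lam_def biclique_system_def card_image inj_on_def)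
  moreover have "card BC = t"
    using bij_betw_same_card[OF assms(5)] by simp
  moreover have "card \<S>' = card \<S>"
    using inj by (simp add: S' card_image)
  moreover have "int (card ?J') = (\<Sum>S\<in>\<S>. int (card S)) - int (weight T')"
    using count by (simp flip: of_nat_sum)
  ultimately show ?thesis
    using BC by (simp add: Let_def card_inequalities)
qed

end
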